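(* Let $X$ and $Y$ be graphs of bounded degree and let $r,p\geq 0$, $s,q\in\mathbb{R}$ be such that $\operatorname{sep}_X(n)\gtrsim n^r\ln(n)^s$ and $\operatorname{sep}_Y(n)\simeq n^p\ln(n)^q$. Then, for any $k$, $$\operatorname{wir}^k_{X\to Y}(n)\gtrsim\begin{cases} n^{r/p}\ln(n)^{(s-q)/p} & \text{if } p>0,\\ \exp\left(n^{r/(q+1)}\ln(n)^{s/(q+1)}\right) & \text{if } p=0.\end{cases}$$
   Context: For functions $f,g:\mathbb{N}\to\mathbb{R}$ (or with values in $\mathbb{R}\cup\{+\infty\}$), $f\lesssim g$ (equivalently $g\gtrsim f$) means there is a constant $C$ such that $f(n)\leq Cg(Cn)+C$ for all $n$; $f\simeq g$ means $f\lesssim g$ and $g\lesssim f$. A graph $\Gamma=(V\Gamma,E\Gamma)$ consists of a set $V\Gamma$ of vertices and a set $E\Gamma$ of unordered pairs of distinct vertices (edges). $\Gamma$ also denotes its topological realisation (one unit interval for each edge, with endpoints labelled by the same vertex identified). $|\Gamma|$ is the number of vertices, and $\Gamma\leq X$ means $\Gamma$ is a subgraph of $X$. For a finite graph $\Gamma$, $\operatorname{cut}(\Gamma)$ is the minimal cardinality of a set $S\subset V\Gamma$ such that no connected component of $\Gamma-S$ contains more than $\frac12|V\Gamma|$ vertices. The separation profile of a graph $X$ is $\operatorname{sep}_X(n)=\max\{\operatorname{cut}(\Gamma) : \Gamma\leq X,\ |V\Gamma|\leq n\}$. A wiring of a graph $\Gamma$ into a graph $\Gamma'$ is a continuous map $f:\Gamma\to\Gamma'$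 such that the image of each vertex is a vertex and the image of each edge is a walk in $\Gamma'$. It is a coarse $k$-wiring if (1) the preimage of each vertex of $\Gamma'$ contains at most $k$ vertices of $\Gamma$, and (2) each edge of $\Gamma'$ is contained in the image of at most $k$ edges of $\Gamma$. The image of a wiring is the subgraph of $\Gamma'$ consisting of all vertices in $f(V\Gamma)$ and all walks which are images of edges; the volume of a wiring is the number of vertices in its image. For a finite graph $\Gamma$ and a graph $Y$, $\operatorname{wir}^k(\Gamma\to Y)$ is the minimal volume of a coarse $k$-wiring of $\Gamma$ into $Y$ ($+\infty$ if none exists). The $k$-wiring profile of $X$ into $Y$ is $\operatorname{wir}^k_{X\to Y}(n)=\max\{\operatorname{wir}^k(\Gamma\to Y) : \Gamma\leq X,\ |\Gamma|\leq n\}$.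
   Formalization: Two hypotheses are added: X is infinite (for finite X with r=0 the claim can fail), and q>-1 when p=0 (at q=-1 the exponents are undefined; for q<-1 the claim can fail, e.g. X=Y a line, r=0, s=-4, q=-3). Excluded cases where it holds have a bounded right-hand side. *)

theory Defs
  imports "HOL-Analysis.Analysis"
begin

section \<open>Asymptotic comparison\<close>

text \<open>The constant is a natural number so that \<open>C * n\<close> is again an argument of \<open>g\<close>.\<close>

definition lesssim :: "(nat \<Rightarrow> ereal) \<Rightarrow> (nat \<Rightarrow> ereal) \<Rightarrow> bool"  (infix "\<lesssim>" 50) where
  "f \<lesssim> g \<longleftrightarrow> (\<exists>C::nat. \<forall>n. f n \<le> ereal (real C) * g (C * n) + ereal (real C))"

definition simeq :: "(nat \<Rightarrow> ereal) \<Rightarrow> (nat \<Rightarrow> ereal) \<Rightarrow> bool"  (infix "\<simeq>" 50) where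
  "f \<simeq> g \<longleftrightarrow> f \<lesssim> g \<and> g \<lesssim> f"


section \<open>Graphs\<close>

record 'a ugraph =
  verts :: "'a set"
  edges :: "'a set set"

definition simple_graph :: "'a ugraph \<Rightarrow> bool" where
  "simple_graph G \<longleftrightarrow>
     (\<forall>e\<in>edges G. \<exists>u v. u \<in> verts G \<and> v \<in> verts G \<and> u \<noteq> v \<and> e = {u, v})"

definition bounded_degree :: "'a ugraph \<Rightarrow> bool" where
  "bounded_degree G \<longleftrightarrow>
     (\<exists>d::nat. \<forall>v\<in>verts G. finite {e\<in>edges G. v \<in> e} \<and> card {e\<in>edges G. v \<in> e} \<le> d)"

definition subgraph :: "'a ugraph \<Rightarrow> 'a ugraph \<Rightarrow> bool" where
  "subgraph H G \<longleftrightarrow> simple_graph H \<and> verts H \<subseteq> verts G \<and> edges H \<subseteq> edges G"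

definition delete_verts :: "'a ugraph \<Rightarrow> 'a set \<Rightarrow> 'a ugraph" where
  "delete_verts G S = \<lparr>verts = verts G - S, edges = {e\<in>edges G. e \<inter> S = {}}\<rparr>"

text \<open>Walks may have length zero, that is, consist of a single vertex.\<close>

definition walk :: "'a ugraph \<Rightarrow> 'a list \<Rightarrow> bool" where
  "walk G xs \<longleftrightarrow>
     xs \<noteq> [] \<and> set xs \<subseteq> verts G \<and> successively (\<lambda>u v. {u, v} \<in> edges G) xs"

definition component_of_vertex :: "'a ugraph \<Rightarrow> 'a \<Rightarrow> 'a set" where
  "component_of_vertex G u = {v. \<exists>xs. walk G xs \<and> hd xs = u \<and> last xs = v}"

definition components :: "'a ugraph \<Rightarrow> 'a set set" where
  "components G = component_of_vertex G ` verts G"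


section \<open>Separation profile\<close>

definition cut_set :: "'a ugraph \<Rightarrow> 'a set \<Rightarrow> bool" where
  "cut_set G S \<longleftrightarrow> S \<subseteq> verts G \<and>
     (\<forall>K\<in>components (delete_verts G S). real (card K) \<le> real (card (verts G)) / 2)"

text \<open>Meaningful for finite graphs; the whole vertex set is always a cut set.\<close>

definition cut_size :: "'a ugraph \<Rightarrow> nat" where
  "cut_size G = (LEAST m. \<exists>S. cut_set G S \<and> card S = m)"

definition small_subgraphs :: "'a ugraph \<Rightarrow> nat \<Rightarrow> 'a ugraph set" where
  "small_subgraphs X n = {G. subgraph G X \<and> finite (verts G) \<and> card (verts G) \<le> n}"

definition sep :: "'a ugraph \<Rightarrow> nat \<Rightarrow> nat" where
  "sep X n = Max (cut_size ` small_subgraphs X n)"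

lemma cut_size_le_card:
  assumes "finite (verts G)"
  shows "cut_size G \<le> card (verts G)"
proof -
  have "components (delete_verts G (verts G)) = {}"
    by (simp add: components_def delete_verts_def)
  then have "cut_set G (verts G)"
    by (simp add: cut_set_def)
  then show ?thesis
    unfolding cut_size_def by (intro Least_le) blast
qed

text \<open>The maximum in the definition of \<open>sep\<close> is over a finite nonempty set of numbers.\<close>

lemma finite_cut_sizes: "finite (cut_size ` small_subgraphs X n)"
proof (rule finite_subset)
  show "cut_size ` small_subgraphs X n \<subseteq> {..n}"
    using cut_size_le_card by (fastforce simp: small_subgraphs_def)
qed simp

lemma small_subgraphs_nonempty: "small_subgraphs X n \<noteq> {}"
proof -
  have "\<lparr>verts = {}, edges = {}\<rparr> \<in> small_subgraphs X n"
    by (simp add: small_subgraphs_def subgraph_def simple_graph_def)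
  then show ?thesis by blast
qed


section \<open>Topological realisation\<close>

text \<open>
  Points are written in barycentric coordinates with respect to the vertices: \<open>cell {v}\<close> consists
  of the point representing the vertex \<open>v\<close> only, and for an edge \<open>e = {u, v}\<close> the set \<open>cell e\<close> is
  the segment joining the points of \<open>u\<close> and \<open>v\<close>. Distinct edges meet only in common endpoints.
\<close>

definition cell :: "'a set \<Rightarrow> ('a \<Rightarrow> real) set" where
  "cell e = {x. (\<forall>a. 0 \<le> x a) \<and> (\<forall>a. a \<notin> e \<longrightarrow> x a = 0) \<and> sum x e = 1}"

definition vertex_point :: "'a \<Rightarrow> 'a \<Rightarrow> real" where
  "vertex_point v = indicator {v}"

definition points :: "'a ugraph \<Rightarrow> ('a \<Rightarrow> real) set" where
  "points G = vertex_point ` verts G \<union> (\<Union>e\<in>edges G. cell e)"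

text \<open>
  The quotient topology from gluing unit intervals along their endpoints (CW topology): a set is
  open iff it meets every edge in a relatively open subset of that edge. On a single edge the
  topology of pointwise convergence is that of a compact interval.
\<close>

definition realisation :: "'a ugraph \<Rightarrow> ('a \<Rightarrow> real) topology" where
  "realisation G = topology (\<lambda>U. U \<subseteq> points G \<and>
     (\<forall>e\<in>edges G. openin (top_of_set (cell e)) (cell e \<inter> U)))"

lemma openin_realisation:
  "openin (realisation G) U \<longleftrightarrow>
     U \<subseteq> points G \<and> (\<forall>e\<in>edges G. openin (top_of_set (cell e)) (cell e \<inter> U))"
proof -
  have "istopology (\<lambda>U. U \<subseteq> points G \<and>
     (\<forall>e\<in>edges G. openin (top_of_set (cell e)) (cell e \<inter> U)))"
    unfolding istopology_def
  proof (intro conjI allI impI ballI)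
    fix S T e
    assume "S \<subseteq> points G \<and> (\<forall>e\<in>edges G. openin (top_of_set (cell e)) (cell e \<inter> S))"
      and "T \<subseteq> points G \<and> (\<forall>e\<in>edges G. openin (top_of_set (cell e)) (cell e \<inter> T))"
      and "e \<in> edges G"
    then have "openin (top_of_set (cell e)) ((cell e \<inter> S) \<inter> (cell e \<inter> T))"
      by (blast intro: openin_Int)
    moreover have "(cell e \<inter> S) \<inter> (cell e \<inter> T) = cell e \<inter> (S \<inter> T)" by blast
    ultimately show "openin (top_of_set (cell e)) (cell e \<inter> (S \<inter> T))" by simp
  next
    fix K e
    assume "\<forall>S\<in>K. S \<subseteq> points G \<and> (\<forall>e\<in>edges G. openin (top_of_set (cell e)) (cell e \<inter> S))"
      and "e \<in> edges G"
    then have "openin (top_of_set (cell e)) (\<Union>S\<in>K. cell e \<inter> S)"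
      by (blast intro: openin_Union)
    moreover have "(\<Union>S\<in>K. cell e \<inter> S) = cell e \<inter> \<Union>K" by blast
    ultimately show "openin (top_of_set (cell e)) (cell e \<inter> \<Union>K)" by simp
  qed auto
  then show ?thesis
    by (simp add: realisation_def topology_inverse')
qed

lemma topspace_realisation: "topspace (realisation G) = points G"
proof -
  have "cell e \<inter> points G = cell e" if "e \<in> edges G" for e
    using that by (auto simp: points_def)
  then have "openin (realisation G) (points G)"
    by (simp add: openin_realisation)
  then show ?thesis
    using openin_realisation[of G "topspace (realisation G)"] openin_subset by fastforce
qed


section \<open>Coarse wirings and wiring profiles\<close>

definition walk_trace :: "'a list \<Rightarrow> ('a \<Rightarrow> real) set" where
  "walk_trace xs = vertex_point ` set xs \<union> (\<Union>i\<in>{i. Suc i < length xs}. cell {xs ! i, xs ! Suc i})"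

definition wiring :: "'a ugraph \<Rightarrow> 'b ugraph \<Rightarrow> (('a \<Rightarrow> real) \<Rightarrow> ('b \<Rightarrow> real)) \<Rightarrow> bool" where
  "wiring G H f \<longleftrightarrow>
     continuous_map (realisation G) (realisation H) f \<and>
     (\<forall>v\<in>verts G. f (vertex_point v) \<in> vertex_point ` verts H) \<and>
     (\<forall>e\<in>edges G. \<exists>u v xs. e = {u, v} \<and> walk H xs \<and>
        vertex_point (hd xs) = f (vertex_point u) \<and> vertex_point (last xs) = f (vertex_point v) \<and>
        f ` cell e = walk_trace xs)"

definition coarse_wiring ::
    "nat \<Rightarrow> 'a ugraph \<Rightarrow> 'b ugraph \<Rightarrow> (('a \<Rightarrow> real) \<Rightarrow> ('b \<Rightarrow> real)) \<Rightarrow> bool" where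
  "coarse_wiring k G H f \<longleftrightarrow>
     wiring G H f \<and>
     (\<forall>w\<in>verts H. card {v\<in>verts G. f (vertex_point v) = vertex_point w} \<le> k) \<and>
     (\<forall>e'\<in>edges H. card {e\<in>edges G. cell e' \<subseteq> f ` cell e} \<le> k)"

definition wiring_image ::
    "'a ugraph \<Rightarrow> 'b ugraph \<Rightarrow> (('a \<Rightarrow> real) \<Rightarrow> ('b \<Rightarrow> real)) \<Rightarrow> 'b ugraph" where
  "wiring_image G H f =
     \<lparr>verts = {w\<in>verts H. (\<exists>v\<in>verts G. f (vertex_point v) = vertex_point w) \<or>
                           (\<exists>e\<in>edges G. vertex_point w \<in> f ` cell e)},
      edges = {e'\<in>edges H. \<exists>e\<in>edges G. cell e' \<subseteq> f ` cell e}\<rparr>"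

definition wiring_volume ::
    "'a ugraph \<Rightarrow> 'b ugraph \<Rightarrow> (('a \<Rightarrow> real) \<Rightarrow> ('b \<Rightarrow> real)) \<Rightarrow> nat" where
  "wiring_volume G H f = card (verts (wiring_image G H f))"

text \<open>For a finite graph \<open>G\<close>; the infimum of the empty set is \<open>\<infinity>\<close>.\<close>

definition wir :: "nat \<Rightarrow> 'a ugraph \<Rightarrow> 'b ugraph \<Rightarrow> enat" where
  "wir k G Y = (INF f\<in>{f. coarse_wiring k G Y f}. enat (wiring_volume G Y f))"

text \<open>
  The supremum is a maximum: \<open>wir k G Y\<close> depends only on the isomorphism type of \<open>G\<close>, and there
  are finitely many types of graphs with at most \<open>n\<close> vertices.
\<close>

definition wir_profile :: "nat \<Rightarrow> 'a ugraph \<Rightarrow> 'b ugraph \<Rightarrow> nat \<Rightarrow> enat" where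
  "wir_profile k X Y n = (SUP G\<in>small_subgraphs X n. wir k G Y)"

end

theory Submission
  imports Defs "HOL-Real_Asymp.Real_Asymp"
begin

text \<open>
  Pushing the vertices of \<open>\<Gamma>\<close> forward along a coarse wiring puts a weight on the image \<open>\<Gamma>'\<close>, and a
  set of vertices of \<open>\<Gamma>'\<close> that separates this weight evenly pulls back to a cut set of \<open>\<Gamma>\<close> of
  comparable size. Bisecting the component carrying most of the weight again and again produces
  such a set of size \<open>\<Sum>\<^sub>i sep(N / 2\<^sup>i)\<close>, which for \<open>p = 0\<close> is of order \<open>ln(N)\<^sup>q\<^sup>+\<^sup>1\<close>. For \<open>r = 0\<close> this is
  not enough, because a constant factor in front of \<open>ln(n)\<^sup>s\<close> cannot be absorbed by rescaling \<open>n\<close>.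
  Instead we use that a finite graph all of whose subgraphs have balanced separators of size \<open>a\<close>
  has, for every weight, a balanced separator of size \<open>O(a)\<close>, in the spirit of the theorem of
  Dvorak and Norin on treewidth. This yields \<open>sep\<^sub>X(n) \<lesssim> sep\<^sub>Y(N)\<close> for the volume \<open>N\<close>, and the
  theorem follows by inverting \<open>y\<^sup>p ln(y)\<^sup>q\<close>.
\<close>

section \<open>Truncated flows\<close>

text \<open>
  In the network on \<open>R\<close> with arc capacities \<open>c\<close>, a source feeding \<open>\<sigma> x\<close> into each \<open>x\<close>, and a sink
  that drains one unit from each vertex of \<open>A\<close>, this is the capacity of the cut with source side \<open>Q\<close>.
\<close>

definition cut_value :: "'a set \<Rightarrow> ('a \<Rightarrow> nat) \<Rightarrow> ('a \<times> 'a \<Rightarrow> nat) \<Rightarrow> 'a set \<Rightarrow> 'a set \<Rightarrow> nat" where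
  "cut_value R \<sigma> c A Q =
     (\<Sum>x\<in>R. \<sigma> x * of_bool (x \<notin> Q)) +
     (\<Sum>e\<in>R \<times> R. c e * of_bool (fst e \<in> Q \<and> snd e \<notin> Q)) +
     (\<Sum>x\<in>R. of_bool (x \<in> Q \<and> x \<in> A))"

text \<open>The inequality holds term by term: the source and drain terms are modular, and for an
  arc it is a check of where its two ends lie. It is what allows tight cuts to be united.\<close>

lemma cut_value_submodular:
  "cut_value R \<sigma> c A (P \<union> Q) + cut_value R \<sigma> c A (P \<inter> Q)
     \<le> cut_value R \<sigma> c A P + cut_value R \<sigma> c A Q"
proof -
  have 1: "(\<Sum>x\<in>R. \<sigma> x * of_bool (x \<notin> P \<union> Q)) + (\<Sum>x\<in>R. \<sigma> x * of_bool (x \<notin> P \<inter> Q))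
      \<le> (\<Sum>x\<in>R. \<sigma> x * of_bool (x \<notin> P)) + (\<Sum>x\<in>R. \<sigma> x * of_bool (x \<notin> Q))"
    unfolding sum.distrib[symmetric] by (rule sum_mono) auto
  have 2: "(\<Sum>e\<in>R\<times>R. c e * of_bool (fst e \<in> P \<union> Q \<and> snd e \<notin> P \<union> Q))
        + (\<Sum>e\<in>R\<times>R. c e * of_bool (fst e \<in> P \<inter> Q \<and> snd e \<notin> P \<inter> Q))
      \<le> (\<Sum>e\<in>R\<times>R. c e * of_bool (fst e \<in> P \<and> snd e \<notin> P))
        + (\<Sum>e\<in>R\<times>R. c e * of_bool (fst e \<in> Q \<and> snd e \<notin> Q))"
    unfolding sum.distrib[symmetric] by (rule sum_mono) auto
  have 3: "(\<Sum>x\<in>R. of_bool (x \<in> P \<union> Q \<and> x \<in> A)) + (\<Sum>x\<in>R. of_bool (x \<in> P \<inter> Q \<and> x \<in> A))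
      \<le> (\<Sum>x\<in>R. of_bool (x \<in> P \<and> x \<in> A)) + (\<Sum>x\<in>R. of_bool (x \<in> Q \<and> x \<in> A) :: nat)"
    unfolding sum.distrib[symmetric] by (rule sum_mono) auto
  from 1 2 3 show ?thesis unfolding cut_value_def by linarith
qed

lemma sum_decrement:
  fixes c :: "'e \<Rightarrow> nat"
  assumes "finite I" "i \<in> I" "0 < c i"
  shows "(\<Sum>e\<in>I. (c(i := c i - 1)) e * h e) + h i = (\<Sum>e\<in>I. c e * h e)"
proof -
  have "(\<Sum>e\<in>I. (c(i := c i - 1)) e * h e) = (c i - 1) * h i + (\<Sum>e\<in>I - {i}. c e * h e)"
    using assms by (subst sum.remove[of _ i]) (auto intro!: sum.cong)
  moreover have "(\<Sum>e\<in>I. c e * h e) = c i * h i + (\<Sum>e\<in>I - {i}. c e * h e)"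
    using assms by (subst sum.remove[of _ i]) auto
  moreover have "c i * h i = (c i - 1) * h i + h i"
    using assms(3) by (cases "c i") auto
  ultimately show ?thesis by simp
qed

text \<open>
  A flow of value \<open>N\<close> in which every vertex that is passed is also drained. Flows are represented
  by the min-cut condition only, so no max-flow theorem is needed: if \<open>c (x, y) > 0\<close> and \<open>x\<close> is not
  drained, one unit of that arc can be traded for draining \<open>x\<close>, which is excluded by minimality.
\<close>

lemma truncated_flow:
  fixes \<sigma> :: "'a \<Rightarrow> nat" and c\<^sub>0 :: "'a \<times> 'a \<Rightarrow> nat"
  assumes fin: "finite R" and cut0: "\<And>Q. N \<le> cut_value R \<sigma> c\<^sub>0 R Q"
  obtains c A where "\<And>e. c e \<le> c\<^sub>0 e" "A \<subseteq> R" "card A \<le> N"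
    "\<And>x y. x \<in> R \<Longrightarrow> y \<in> R \<Longrightarrow> 0 < c (x, y) \<Longrightarrow> x \<in> A \<and> y \<in> A"
    "\<And>Q. N \<le> cut_value R \<sigma> c A Q"
proof -
  define ok where "ok = (\<lambda>(c, A). (\<forall>e. c e \<le> c\<^sub>0 e) \<and> A \<subseteq> R \<and> (\<forall>Q. N \<le> cut_value R \<sigma> c A Q))"
  \<comment> \<open>The factor \<open>card R + 1\<close> makes the order lexicographic: since
    \<open>card A\<close> never exceeds \<open>card R\<close>, saving one unit of capacity outweighs
    any growth of \<open>A\<close>.\<close>
  define size where "size = (\<lambda>(c :: 'a \<times> 'a \<Rightarrow> nat, A :: 'a set). (\<Sum>e\<in>R\<times>R. c e) * (card R + 1) + card A)"
  have "ok (c\<^sub>0, R)" using cut0 by (simp add: ok_def)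
  then obtain cA where cA: "ok cA" and least: "\<And>z. ok z \<Longrightarrow> size cA \<le> size z"
    using ex_has_least_nat[of ok "(c\<^sub>0, R)" size] by blast
  obtain c A where cA_eq: "cA = (c, A)" by (cases cA)
  have c_le: "\<And>e. c e \<le> c\<^sub>0 e" and A_sub: "A \<subseteq> R"
    and cut: "\<And>Q. N \<le> cut_value R \<sigma> c A Q"
    using cA by (auto simp: cA_eq ok_def)
  have least': "(\<Sum>e\<in>R\<times>R. c e) * (card R + 1) + card A
      \<le> (\<Sum>e\<in>R\<times>R. c' e) * (card R + 1) + card A'" if "ok (c', A')" for c' A'
    using least[OF that] by (simp add: size_def cA_eq)
  have finA: "finite A" using A_sub fin finite_subset by blast
  have decrement_not_ok: "\<not> ok (c(e := c e - 1), A')"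
    if e: "e \<in> R \<times> R" "0 < c e" and A': "A' \<subseteq> R" for e A'
  proof
    assume "ok (c(e := c e - 1), A')"
    from least'[OF this]
    have "(\<Sum>z\<in>R\<times>R. c z) * (card R + 1)
        \<le> (\<Sum>z\<in>R\<times>R. (c(e := c e - 1)) z) * (card R + 1) + card A'" by linarith
    moreover have "(\<Sum>z\<in>R\<times>R. c z) = (\<Sum>z\<in>R\<times>R. (c(e := c e - 1)) z) + 1"
      using sum_decrement[of "R \<times> R" e c "\<lambda>_. 1"] e fin by simp
    moreover have "card A' \<le> card R" using A' fin card_mono by blast
    ultimately show False by (simp only: distrib_right add_le_cancel_left) simp
  qed
  have c'_le: "(c(e := c e - 1)) z \<le> c\<^sub>0 z" for e z
    using c_le[of z] by auto
  have tail: "x \<in> A" if xy: "x \<in> R" "y \<in> R" "0 < c (x, y)" for x y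
  proof (rule ccontr)
    assume "x \<notin> A"
    have "N \<le> cut_value R \<sigma> (c((x, y) := c (x, y) - 1)) (insert x A) Q" for Q
    proof -
      have "(\<Sum>z\<in>R. of_bool (z \<in> Q \<and> z \<in> insert x A) :: nat)
          = (\<Sum>z\<in>R. of_bool (z \<in> Q \<and> z \<in> A)) + (\<Sum>z\<in>R. of_bool (z = x \<and> x \<in> Q))"
        unfolding sum.distrib[symmetric] using \<open>x \<notin> A\<close> by (intro sum.cong) auto
      also have "(\<Sum>z\<in>R. of_bool (z = x \<and> x \<in> Q) :: nat) = of_bool (x \<in> Q)"
        using fin xy by (subst sum.remove[of _ x]) auto
      finally have ends: "(\<Sum>z\<in>R. of_bool (z \<in> Q \<and> z \<in> insert x A) :: nat)
          = (\<Sum>z\<in>R. of_bool (z \<in> Q \<and> z \<in> A)) + of_bool (x \<in> Q)" .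
      have "(\<Sum>e\<in>R\<times>R. (c((x, y) := c (x, y) - 1)) e * of_bool (fst e \<in> Q \<and> snd e \<notin> Q))
            + of_bool (x \<in> Q \<and> y \<notin> Q)
          = (\<Sum>e\<in>R\<times>R. c e * of_bool (fst e \<in> Q \<and> snd e \<notin> Q))"
        using sum_decrement[of "R \<times> R" "(x, y)" c "\<lambda>e. of_bool (fst e \<in> Q \<and> snd e \<notin> Q)"] fin xy
        by simp
      moreover have "(of_bool (x \<in> Q \<and> y \<notin> Q) :: nat) \<le> of_bool (x \<in> Q)" by simp
      ultimately have "cut_value R \<sigma> c A Q \<le> cut_value R \<sigma> (c((x, y) := c (x, y) - 1)) (insert x A) Q"
        unfolding cut_value_def ends by linarith
      then show ?thesis using cut[of Q] by linarith
    qed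
    then have "ok (c((x, y) := c (x, y) - 1), insert x A)"
      using c'_le A_sub xy unfolding ok_def prod.case by blast
    then show False using decrement_not_ok[of "(x, y)" "insert x A"] xy A_sub by auto
  qed
  \<comment> \<open>If \<open>y\<close> were not drained, no capacity would leave \<open>y\<close>
    by \<open>tail\<close>. Moving \<open>y\<close> to the source side of a cut crossed by
    \<open>(x, y)\<close> then saves that arc and costs nothing, so these cuts have a unit to spare
    and the arc could be decremented.\<close>
  have head: "y \<in> A" if xy: "x \<in> R" "y \<in> R" "0 < c (x, y)" for x y
  proof (rule ccontr)
    assume "y \<notin> A"
    then have out0: "c (y, z) = 0" if "z \<in> R" for z
      using tail[of y z] xy that by auto
    have "N \<le> cut_value R \<sigma> (c((x, y) := c (x, y) - 1)) A Q" for Q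
    proof (cases "x \<in> Q \<and> y \<notin> Q")
      case True
      have 1: "(\<Sum>z\<in>R. \<sigma> z * of_bool (z \<notin> insert y Q)) \<le> (\<Sum>z\<in>R. \<sigma> z * of_bool (z \<notin> Q))"
        by (rule sum_mono) auto
      have 2: "(\<Sum>e\<in>R\<times>R. c e * of_bool (fst e \<in> insert y Q \<and> snd e \<notin> insert y Q))
         \<le> (\<Sum>e\<in>R\<times>R. (c((x, y) := c (x, y) - 1)) e * of_bool (fst e \<in> Q \<and> snd e \<notin> Q))"
        by (rule sum_mono) (use out0 True in auto)
      have 3: "(\<Sum>z\<in>R. of_bool (z \<in> insert y Q \<and> z \<in> A) :: nat) = (\<Sum>z\<in>R. of_bool (z \<in> Q \<and> z \<in> A))"
        by (rule sum.cong) (use \<open>y \<notin> A\<close> in auto)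
      show ?thesis using 1 2 3 cut[of "insert y Q"] unfolding cut_value_def by linarith
    next
      case False
      then have "cut_value R \<sigma> (c((x, y) := c (x, y) - 1)) A Q = cut_value R \<sigma> c A Q"
        using sum_decrement[of "R \<times> R" "(x, y)" c "\<lambda>e. of_bool (fst e \<in> Q \<and> snd e \<notin> Q)"] fin xy
        unfolding cut_value_def by auto
      then show ?thesis using cut by simp
    qed
    then have "ok (c((x, y) := c (x, y) - 1), A)"
      using c'_le A_sub unfolding ok_def prod.case by blast
    then show False using decrement_not_ok[of "(x, y)" A] xy A_sub by auto
  qed
  \<comment> \<open>Dropping \<open>v\<close> from \<open>A\<close> lowers exactly the cuts with
    \<open>v\<close> on the source side, each by one. Minimality in \<open>card A\<close> therefore
    makes one of them tight.\<close>
  have "\<exists>Q. v \<in> Q \<and> cut_value R \<sigma> c A Q = N" if v: "v \<in> A" for v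
  proof (rule ccontr)
    assume no: "\<not> (\<exists>Q. v \<in> Q \<and> cut_value R \<sigma> c A Q = N)"
    have "N \<le> cut_value R \<sigma> c (A - {v}) Q" for Q
    proof -
      have "(\<Sum>z\<in>R. of_bool (z \<in> Q \<and> z \<in> A) :: nat)
          = (\<Sum>z\<in>R. of_bool (z \<in> Q \<and> z \<in> A - {v})) + (\<Sum>z\<in>R. of_bool (z = v \<and> v \<in> Q))"
        unfolding sum.distrib[symmetric] using v by (intro sum.cong) auto
      also have "(\<Sum>z\<in>R. of_bool (z = v \<and> v \<in> Q) :: nat) = of_bool (v \<in> Q)"
        using fin v A_sub by (subst sum.remove[of _ v]) auto
      finally have "cut_value R \<sigma> c A Q = cut_value R \<sigma> c (A - {v}) Q + of_bool (v \<in> Q)"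
        unfolding cut_value_def by simp
      moreover have "v \<in> Q \<Longrightarrow> cut_value R \<sigma> c A Q \<noteq> N" using no by blast
      ultimately show ?thesis using cut[of Q] by (cases "v \<in> Q") auto
    qed
    then have "ok (c, A - {v})" using c_le A_sub unfolding ok_def prod.case by blast
    from least'[OF this] have "card A \<le> card (A - {v})" by simp
    then show False using v finA by (meson card_Diff1_less not_less)
  qed
  then obtain Qv where Qv: "\<And>v. v \<in> A \<Longrightarrow> v \<in> Qv v \<and> cut_value R \<sigma> c A (Qv v) = N"
    by metis
  \<comment> \<open>Uncrossing: the union and the intersection of two tight source sides have values
    summing to at most \<open>2 * N\<close>, and neither falls below \<open>N\<close>.\<close>
  have tight: "I = {} \<or> cut_value R \<sigma> c A (\<Union>v\<in>I. Qv v) = N" if "finite I" "I \<subseteq> A" for I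
    using that
  proof (induction I rule: finite_induct)
    case (insert v I)
    show ?case
    proof (cases "I = {}")
      case False
      then have "cut_value R \<sigma> c A (\<Union>v\<in>I. Qv v) = N" using insert by auto
      moreover have "cut_value R \<sigma> c A (Qv v) = N" using Qv insert by auto
      ultimately have "cut_value R \<sigma> c A (Qv v \<union> (\<Union>v\<in>I. Qv v)) \<le> N"
        using cut_value_submodular[of R \<sigma> c A "Qv v" "\<Union>v\<in>I. Qv v"]
          cut[of "Qv v \<inter> (\<Union>v\<in>I. Qv v)"] by linarith
      then show ?thesis using cut[of "Qv v \<union> (\<Union>v\<in>I. Qv v)"] by simp
    qed (use Qv insert in auto)
  qed simp
  \<comment> \<open>The union of the tight sets contains all of \<open>A\<close>, so its drain term
    alone is \<open>card A\<close>.\<close>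
  have "card A \<le> N"
  proof (cases "A = {}")
    case False
    let ?Q = "\<Union>v\<in>A. Qv v"
    have "A \<subseteq> ?Q" using Qv by blast
    then have "(\<Sum>x\<in>R. of_bool (x \<in> ?Q \<and> x \<in> A) :: nat) = (\<Sum>x\<in>R. of_bool (x \<in> A))"
      by (intro sum.cong) auto
    also have "\<dots> = card A" using A_sub fin by (simp add: sum_of_bool_eq Int_absorb1)
    finally show ?thesis using tight[OF finA] False unfolding cut_value_def by simp
  qed simp
  with c_le A_sub tail head cut show thesis using that by blast
qed

section \<open>Balanced separators for arbitrary weights\<close>

definition reach :: "('a \<Rightarrow> 'a \<Rightarrow> bool) \<Rightarrow> 'a set \<Rightarrow> 'a \<Rightarrow> 'a \<Rightarrow> bool" where
  "reach E U = (\<lambda>x y. E x y \<and> x \<in> U \<and> y \<in> U)\<^sup>*\<^sup>*"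

definition reach_set :: "('a \<Rightarrow> 'a \<Rightarrow> bool) \<Rightarrow> 'a set \<Rightarrow> 'a \<Rightarrow> 'a set" where
  "reach_set E U u = {v. reach E U u v}"

definition connected_in :: "('a \<Rightarrow> 'a \<Rightarrow> bool) \<Rightarrow> 'a set \<Rightarrow> bool" where
  "connected_in E B \<longleftrightarrow> (\<forall>x\<in>B. \<forall>y\<in>B. reach E B x y)"

lemma reach_mono: "reach E U x y \<Longrightarrow> U \<subseteq> W \<Longrightarrow> reach E W x y"
  unfolding reach_def by (rule rtranclp_mono[THEN predicate2D, rotated]) auto

lemma reach_closed:
  assumes "reach E U x y" "x \<in> C" "\<And>a b. a \<in> C \<Longrightarrow> a \<in> U \<Longrightarrow> b \<in> U \<Longrightarrow> E a b \<Longrightarrow> b \<in> C"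
  shows "y \<in> C"
  using assms(1,2) unfolding reach_def
  by (induction rule: rtranclp_induct) (use assms(3) in auto)

lemma reach_sym: "symp E \<Longrightarrow> reach E U x y \<Longrightarrow> reach E U y x"
  unfolding reach_def
  by (rule sympD[OF symp_rtranclp]) (auto simp: symp_def)

lemma reach_trans: "reach E U x y \<Longrightarrow> reach E U y z \<Longrightarrow> reach E U x z"
  unfolding reach_def by (rule rtranclp_trans)

lemma reach_set_subset: "u \<in> U \<Longrightarrow> reach_set E U u \<subseteq> U"
  unfolding reach_set_def using reach_closed[of E U u _ U] by blast

lemma reach_set_step: "v \<in> reach_set E U u \<Longrightarrow> v \<in> U \<Longrightarrow> w \<in> U \<Longrightarrow> E v w \<Longrightarrow> w \<in> reach_set E U u"
  unfolding reach_set_def reach_def by (simp add: rtranclp.rtrancl_into_rtrancl)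

text \<open>Every vertex on a path from \<open>u\<close> inside \<open>U\<close> is itself reached,
  so the path never leaves the component. This makes components connected in themselves.\<close>

lemma reach_in_reach_set: "reach E U u v \<Longrightarrow> reach E (reach_set E U u) u v"
  unfolding reach_def
proof (induction rule: rtranclp_induct)
  case (step y z)
  then have "y \<in> reach_set E U u" "z \<in> reach_set E U u"
    by (auto simp: reach_set_def reach_def intro: rtranclp.rtrancl_into_rtrancl)
  with step show ?case by (simp add: rtranclp.rtrancl_into_rtrancl)
qed simp

lemma connected_in_reach_set: "symp E \<Longrightarrow> connected_in E (reach_set E U u)"
  unfolding connected_in_def by (metis reach_set_def mem_Collect_eq reach_in_reach_set reach_sym reach_trans)

lemma connected_in_subset_reach_set: "connected_in E B \<Longrightarrow> B \<subseteq> U \<Longrightarrow> u \<in> B \<Longrightarrow> B \<subseteq> reach_set E U u"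
  unfolding connected_in_def reach_set_def by (blast intro: reach_mono)

section \<open>Vertex boundaries in a finite graph\<close>

locale finite_symmetric =
  fixes V :: "'a set" and E :: "'a \<Rightarrow> 'a \<Rightarrow> bool"
  assumes finV: "finite V" and symE: "symp E"
begin

definition boundary :: "'a set \<Rightarrow> 'a set" where
  "boundary B = {y \<in> V - B. \<exists>x\<in>B. E x y}"

lemma boundary_subset: "boundary B \<subseteq> V - B" by (auto simp: boundary_def)

lemma finite_boundary: "finite (boundary B)" using boundary_subset finV finite_subset by blast

lemma boundary_reach_set:
  assumes "u \<in> V - Z"
  shows "boundary (reach_set E (V - Z) u) \<subseteq> Z"
proof
  fix y assume "y \<in> boundary (reach_set E (V - Z) u)"
  then obtain x where x: "y \<in> V" "y \<notin> reach_set E (V - Z) u" "x \<in> reach_set E (V - Z) u" "E x y"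
    by (auto simp: boundary_def)
  then show "y \<in> Z" using reach_set_step[of x E "V - Z" u y] reach_set_subset[OF assms, of E] by blast
qed

text \<open>A path inside \<open>B\<close> that starts in \<open>C\<close> could leave
  \<open>C\<close> only through the boundary of \<open>C\<close>.\<close>

lemma connected_in_subset:
  assumes "connected_in E B" "B \<subseteq> V" "B \<inter> C \<noteq> {}" "boundary C \<inter> B = {}"
  shows "B \<subseteq> C"
proof
  fix y assume "y \<in> B"
  obtain x where "x \<in> B" "x \<in> C" using assms(3) by blast
  then have "reach E B x y" using assms(1) \<open>y \<in> B\<close> by (auto simp: connected_in_def)
  then show "y \<in> C"
    by (rule reach_closed) (use \<open>x \<in> C\<close> assms(2,4) in \<open>auto simp: boundary_def\<close>)
qed

end

text \<open>
  Suppose there is no such separator. Then every small \<open>Z\<close> leaves a component with more than half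
  of the weight; these heavy regions pairwise meet. Take a region \<open>B\<close> much smaller than every region
  with boundary at most \<open>t\<close>, and with boundary \<open>S\<close> of least size. Since regions with boundary at most
  \<open>t\<close> are large, \<open>t * w\<close> units can flow from \<open>S\<close> into the complement of \<open>B\<close>, draining one unit per
  vertex. A balanced separator of the subgraph on \<open>B\<close>, \<open>S\<close> and the drained set \<open>A\<close> stops only
  \<open>O(a) * w\<close> of it, by minimality of \<open>S\<close>, so most of \<open>A\<close> stays in one component, a contradiction.
\<close>

theorem balanced_weighted_separator:
  fixes V :: "'a set" and E :: "'a \<Rightarrow> 'a \<Rightarrow> bool" and \<mu> :: "'a \<Rightarrow> nat" and a d :: nat
  assumes "finite V" and "symp E" and "0 < a"
    and deg: "\<And>v. v \<in> V \<Longrightarrow> card {u \<in> V. E u v} \<le> d"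
    and bal: "\<And>U. U \<subseteq> V \<Longrightarrow>
      \<exists>Z\<subseteq>U. card Z \<le> a \<and> (\<forall>u\<in>U - Z. 2 * card (reach_set E (U - Z) u) \<le> card U)"
  shows "\<exists>S\<subseteq>V. card S \<le> (24 * d + 58) * a \<and>
      (\<forall>u\<in>V - S. 2 * sum \<mu> (reach_set E (V - S) u) \<le> sum \<mu> V)"
proof (rule ccontr)
  interpret finite_symmetric V E using assms by unfold_locales
  assume contr: "\<not> ?thesis"
  define region where "region B \<longleftrightarrow> B \<subseteq> V \<and> connected_in E B \<and> sum \<mu> V < 2 * sum \<mu> B" for B
  \<comment> \<open>\<open>t\<close> is four times \<open>(2 + d) * a\<close>, the factor of the
    flow lost in the final cut. \<open>\<theta>\<close> equals \<open>6 * t + 10 * a\<close>, which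
    leaves room to delete \<open>B\<^sub>1\<close> (fewer than \<open>5 * t + 10 * a\<close>
    vertices, as it turns out) together with its boundary (at most \<open>t\<close>).\<close>
  define \<theta> where "\<theta> = (24 * d + 58) * a"
  define t where "t = 4 * (2 + d) * a"
  have \<theta>_eq: "\<theta> = 6 * t + 10 * a" by (simp add: \<theta>_def t_def algebra_simps)
  have t_pos: "0 < t" using \<open>0 < a\<close> by (simp add: t_def)
  have t_ge: "4 * a \<le> t" by (simp add: t_def)
  have finV': "\<And>B. B \<subseteq> V \<Longrightarrow> finite B" using finV finite_subset by blast
  have region_avoiding: "\<exists>B. region B \<and> B \<inter> Z = {} \<and> boundary B \<subseteq> Z" if "Z \<subseteq> V" "card Z \<le> \<theta>" for Z
  proof -
    obtain u where u: "u \<in> V - Z" "sum \<mu> V < 2 * sum \<mu> (reach_set E (V - Z) u)"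
      using contr \<open>Z \<subseteq> V\<close> \<open>card Z \<le> \<theta>\<close> unfolding \<theta>_def by (meson not_less)
    have "region (reach_set E (V - Z) u)"
      using u reach_set_subset[of u "V - Z" E] connected_in_reach_set[OF symE] by (auto simp: region_def)
    then show ?thesis using boundary_reach_set[OF u(1)] reach_set_subset[OF u(1), of E] by blast
  qed
  have regions_meet: "B \<inter> C \<noteq> {}" if "region B" "region C" for B C
  proof
    assume "B \<inter> C = {}"
    moreover have BC: "B \<subseteq> V" "C \<subseteq> V" using that by (auto simp: region_def)
    ultimately have "sum \<mu> B + sum \<mu> C \<le> sum \<mu> V"
      using finV finV' by (subst sum.union_disjoint[symmetric]) (auto intro!: sum_mono2)
    then show False using that by (auto simp: region_def)
  qed
  have region_subset: "B \<subseteq> C" if "region B" "region C" "boundary C \<inter> B = {}" for B C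
    using connected_in_subset[of B C] regions_meet[of B C] that by (auto simp: region_def)
  \<comment> \<open>Delete the boundary of \<open>B\<close> and a balanced separator
    \<open>Z\<close> of \<open>B\<close>. The surviving region meets \<open>B\<close> but not its
    boundary, so it lies in a single component of \<open>B - Z\<close>. Its boundary grows by at
    most \<open>a\<close>.\<close>
  have halving: "\<exists>C. region C \<and> card (boundary C) \<le> m + a \<and> 2 * card C \<le> card B"
    if B: "region B" "card (boundary B) \<le> m" and m: "m + a \<le> \<theta>" for B m
  proof -
    have BV: "B \<subseteq> V" using B by (simp add: region_def)
    obtain Z where Z: "Z \<subseteq> B" "card Z \<le> a"
      and half: "\<And>u. u \<in> B - Z \<Longrightarrow> 2 * card (reach_set E (B - Z) u) \<le> card B"
      using bal[OF BV] by blast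
    have card: "card (boundary B \<union> Z) \<le> m + a"
      using card_Un_le[of "boundary B" Z] B(2) Z(2) by linarith
    moreover have "boundary B \<union> Z \<subseteq> V" using boundary_subset Z BV by blast
    ultimately obtain C where C: "region C" "C \<inter> (boundary B \<union> Z) = {}" "boundary C \<subseteq> boundary B \<union> Z"
      using region_avoiding[of "boundary B \<union> Z"] m by auto
    then have "C \<subseteq> B - Z" using region_subset[of C B] B(1) by blast
    moreover obtain u where "u \<in> C" using regions_meet[OF C(1) C(1)] by blast
    ultimately have "C \<subseteq> reach_set E (B - Z) u"
      using C(1) connected_in_subset_reach_set[of E C "B - Z" u] \<open>u \<in> C\<close> unfolding region_def by blast
    moreover have "u \<in> B - Z" using \<open>u \<in> C\<close> \<open>C \<subseteq> B - Z\<close> by blast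
    moreover have "finite (reach_set E (B - Z) u)"
      using reach_set_subset[OF \<open>u \<in> B - Z\<close>, of E] finV'[OF BV] finite_subset by blast
    ultimately have "2 * card C \<le> card B"
      using half[of u] card_mono[of "reach_set E (B - Z) u" C] by linarith
    moreover have "card (boundary C) \<le> m + a"
      using card_mono[OF _ C(3)] card finite_boundary finV'[of Z] Z BV by fastforce
    ultimately show ?thesis using C(1) by blast
  qed
  obtain B\<^sub>0 where "region B\<^sub>0" "boundary B\<^sub>0 \<subseteq> {}" using region_avoiding[of "{}"] by auto
  then have "region B\<^sub>0 \<and> card (boundary B\<^sub>0) \<le> t" by simp
  then obtain B\<^sub>1 where B\<^sub>1: "region B\<^sub>1" "card (boundary B\<^sub>1) \<le> t"
    and B\<^sub>1_least: "\<And>B. region B \<Longrightarrow> card (boundary B) \<le> t \<Longrightarrow> card B\<^sub>1 \<le> card B"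
    using ex_has_least_nat[of "\<lambda>B. region B \<and> card (boundary B) \<le> t" B\<^sub>0 card] by blast
  \<comment> \<open>Three halvings give the factor 8, so that the \<open>3 * card B\<close> arising
    in the final estimate is absorbed by \<open>card B\<^sub>1\<close>. They raise the boundary to
    at most \<open>t + 3 * a\<close>.\<close>
  obtain B\<^sub>2 where B\<^sub>2: "region B\<^sub>2" "card (boundary B\<^sub>2) \<le> t + a" "2 * card B\<^sub>2 \<le> card B\<^sub>1"
    using halving[OF B\<^sub>1] \<theta>_eq t_ge by auto
  obtain B\<^sub>3 where B\<^sub>3: "region B\<^sub>3" "card (boundary B\<^sub>3) \<le> t + a + a" "2 * card B\<^sub>3 \<le> card B\<^sub>2"
    using halving[OF B\<^sub>2(1,2)] \<theta>_eq t_ge by auto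
  obtain B\<^sub>4 where B\<^sub>4: "region B\<^sub>4" "card (boundary B\<^sub>4) \<le> t + a + a + a" "2 * card B\<^sub>4 \<le> card B\<^sub>3"
    using halving[OF B\<^sub>3(1,2)] \<theta>_eq t_ge by auto
  define small where "small B \<longleftrightarrow> region B \<and> card (boundary B) \<le> t + 3 * a \<and> 8 * card B \<le> card B\<^sub>1" for B
  have "small B\<^sub>4" using B\<^sub>2 B\<^sub>3 B\<^sub>4 by (simp add: small_def)
  then obtain B where B_small: "small B"
    and B_least: "\<And>C. small C \<Longrightarrow> card (boundary B) \<le> card (boundary C)"
    using ex_has_least_nat[of small B\<^sub>4 "\<lambda>B. card (boundary B)"] by blast
  have B: "region B" "card (boundary B) \<le> t + 3 * a" "8 * card B \<le> card B\<^sub>1"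
    using B_small by (auto simp: small_def)
  define S where "S = boundary B"
  define R where "R = V - B"
  \<comment> \<open>All source and arc capacities will be \<open>w\<close>. As \<open>t * w\<close>
    is at most \<open>card B\<^sub>1 - card B\<close>, a cut reaches \<open>t * w\<close> either by
    \<open>t\<close> crossings of cost \<open>w\<close> or by draining that many vertices.\<close>
  define w where "w = (card B\<^sub>1 - card B) div t"
  have BV: "B \<subseteq> V" using B by (simp add: region_def)
  have S_sub: "S \<subseteq> R" using boundary_subset by (auto simp: S_def R_def)
  have finR: "finite R" using finV by (simp add: R_def)
  have finS: "finite S" using S_sub finR finite_subset by blast
  have finB: "finite B" using BV finV' by blast
  define \<sigma> where "\<sigma> x = (if x \<in> S then w else 0)" for x
  define c\<^sub>0 where "c\<^sub>0 e = (if E (fst e) (snd e) then w else 0)" for e :: "'a \<times> 'a"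
  have sum_\<sigma>: "(\<Sum>x\<in>R. \<sigma> x * of_bool (x \<notin> Q)) = w * card (S - Q)" for Q
  proof -
    have "(\<Sum>x\<in>R. \<sigma> x * of_bool (x \<notin> Q)) = (\<Sum>x\<in>R. if x \<in> S - Q then w else 0)"
      by (rule sum.cong) (auto simp: \<sigma>_def)
    also have "\<dots> = (\<Sum>x\<in>S - Q. w)"
      using finR S_sub by (intro sum.mono_neutral_cong_right) auto
    finally show ?thesis by simp
  qed
  have sum_c\<^sub>0: "(\<Sum>e\<in>R \<times> R. c\<^sub>0 e * of_bool (fst e \<in> Q \<and> snd e \<notin> Q))
      = w * card {e \<in> R \<times> R. E (fst e) (snd e) \<and> fst e \<in> Q \<and> snd e \<notin> Q}" (is "_ = w * card ?D") for Q
  proof -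
    have "(\<Sum>e\<in>R \<times> R. c\<^sub>0 e * of_bool (fst e \<in> Q \<and> snd e \<notin> Q)) = (\<Sum>e\<in>?D. w)"
      using finR by (intro sum.mono_neutral_cong_right) (auto simp: c\<^sub>0_def)
    then show ?thesis by simp
  qed
  have sum_of_bool: "(\<Sum>x\<in>R. of_bool (x \<in> Q \<and> x \<in> A)) = card (Q \<inter> A \<inter> R)" for Q A
    using finR by (simp add: sum_of_bool_eq) (rule arg_cong[of _ _ card], auto)
  have "t * w \<le> cut_value R \<sigma> c\<^sub>0 R Q" for Q
  proof -
    \<comment> \<open>\<open>Z\<close> holds the vertices at which the cut is crossed and contains
      the boundary of \<open>B \<union> (Q \<inter> R)\<close>. If \<open>card Z < t\<close>, a
      region avoiding \<open>Z\<close> is at least as large as \<open>B\<^sub>1\<close> and is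
      trapped in \<open>B \<union> (Q \<inter> R)\<close>, which forces \<open>Q\<close> to be
      large.\<close>
    define Z where "Z = (S - Q) \<union> {y \<in> R - Q. \<exists>x\<in>Q \<inter> R. E x y}"
    let ?D = "{e \<in> R \<times> R. E (fst e) (snd e) \<and> fst e \<in> Q \<and> snd e \<notin> Q}"
    have finD: "finite ?D" using finR by simp
    have "{y \<in> R - Q. \<exists>x\<in>Q \<inter> R. E x y} = snd ` ?D" by force
    then have "card Z \<le> card (S - Q) + card ?D"
      unfolding Z_def using card_Un_le[of "S - Q" "snd ` ?D"] card_image_le[OF finD, of snd] by auto
    then have "w * card Z \<le> w * card (S - Q) + w * card ?D"
      using mult_le_mono2[of "card Z" "card (S - Q) + card ?D" w] by (simp only: distrib_left)
    then have cut_ge: "w * card Z + card (Q \<inter> R) \<le> cut_value R \<sigma> c\<^sub>0 R Q"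
      using sum_of_bool[of Q R] by (simp add: cut_value_def sum_\<sigma> sum_c\<^sub>0)
    show ?thesis
    proof (cases "t \<le> card Z")
      case True
      then have "t * w \<le> w * card Z" by (simp add: mult.commute)
      then show ?thesis using cut_ge by linarith
    next
      case False
      have "Z \<subseteq> V" using S_sub by (auto simp: Z_def R_def)
      then obtain C where C: "region C" "C \<inter> Z = {}" "boundary C \<subseteq> Z"
        using region_avoiding[of Z] False \<theta>_eq by auto
      have "card (boundary C) \<le> t"
        using card_mono[OF _ C(3)] finV'[OF \<open>Z \<subseteq> V\<close>] False by linarith
      then have "card B\<^sub>1 \<le> card C" using B\<^sub>1_least C(1) by blast
      have "boundary (B \<union> (Q \<inter> R)) \<subseteq> Z"
        by (auto simp: boundary_def Z_def R_def S_def)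
      moreover have "C \<inter> (B \<union> (Q \<inter> R)) \<noteq> {}" using regions_meet[OF C(1) B(1)] by blast
      ultimately have "C \<subseteq> B \<union> (Q \<inter> R)"
        using connected_in_subset[of C "B \<union> (Q \<inter> R)"] C by (auto simp: region_def)
      then have "card C \<le> card B + card (Q \<inter> R)"
        using card_mono[of "B \<union> (Q \<inter> R)" C] card_Un_le[of B "Q \<inter> R"] finB finR by simp
      moreover have "t * w \<le> card B\<^sub>1 - card B" by (simp add: w_def)
      ultimately show ?thesis using cut_ge \<open>card B\<^sub>1 \<le> card C\<close> by linarith
    qed
  qed
  then obtain c A where c_le: "\<And>e. c e \<le> c\<^sub>0 e" and A: "A \<subseteq> R" "card A \<le> t * w"
    and cA: "\<And>x y. x \<in> R \<Longrightarrow> y \<in> R \<Longrightarrow> 0 < c (x, y) \<Longrightarrow> x \<in> A \<and> y \<in> A"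
    and cut: "\<And>Q. t * w \<le> cut_value R \<sigma> c A Q"
    using truncated_flow[OF finR, of "t * w" \<sigma> c\<^sub>0] by blast
  have c_le_w: "c e \<le> w" for e
    using c_le[of e] by (auto simp: c\<^sub>0_def split: if_splits)
  define U where "U = B \<union> S \<union> A"
  have UV: "U \<subseteq> V" using BV S_sub A by (auto simp: U_def R_def)
  have "card U \<le> card B + card S + card A"
    unfolding U_def using card_Un_le[of "B \<union> S" A] card_Un_le[of B S] by linarith
  then have card_U: "card U \<le> card B + card S + t * w" using A(2) by linarith
  obtain Z where Z: "Z \<subseteq> U" "card Z \<le> a"
    and half: "\<And>u. u \<in> U - Z \<Longrightarrow> 2 * card (reach_set E (U - Z) u) \<le> card U"
    using bal[OF UV] by blast
  have finZ: "finite Z" using Z UV finV' by blast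
  have "card (S \<union> Z) \<le> \<theta>"
    using card_Un_le[of S Z] B(2) Z(2) \<theta>_eq t_ge by (simp add: S_def)
  moreover have "S \<union> Z \<subseteq> V" using S_sub Z UV by (auto simp: R_def)
  ultimately obtain C where C: "region C" "C \<inter> (S \<union> Z) = {}" "boundary C \<subseteq> S \<union> Z"
    using region_avoiding by blast
  have CB: "C \<subseteq> B" using region_subset[OF C(1) B(1)] C(2) by (auto simp: S_def)
  have card_CB: "card C \<le> card B" using card_mono[OF finB CB] .
  \<comment> \<open>Being contained in \<open>B\<close>, the region \<open>C\<close> competes with
    \<open>B\<close> for the least boundary unless its boundary exceeds \<open>t + 3 * a\<close>,
    and then there is nothing to show.\<close>
  have bdB_le: "card (boundary B) \<le> card (boundary C)"
  proof (cases "card (boundary C) \<le> t + 3 * a")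
    case True
    then show ?thesis using B_least[of C] C(1) card_CB B(3) by (auto simp: small_def)
  next
    case False
    then show ?thesis using B(2) by linarith
  qed
  \<comment> \<open>Outside \<open>S\<close> the boundary of \<open>C\<close> has at most
    \<open>a\<close> vertices. As it is no smaller than \<open>S\<close>, all but at most
    \<open>a\<close> vertices of \<open>S\<close> are adjacent to \<open>C\<close>; those not in
    \<open>Z\<close> then belong to the component \<open>K\<close> of \<open>C\<close>.\<close>
  have "boundary C \<subseteq> (S \<inter> boundary C) \<union> Z" using C(3) by blast
  then have "card (boundary C) \<le> card (S \<inter> boundary C) + card Z"
    using card_mono[of "(S \<inter> boundary C) \<union> Z" "boundary C"] finS finZ card_Un_le[of "S \<inter> boundary C" Z] by simp
  with bdB_le have "card S \<le> card (S \<inter> boundary C) + card Z" by (simp add: S_def)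
  moreover have "card S = card (S \<inter> boundary C) + card (S - boundary C)"
    using finS by (rule card_Int_Diff)
  ultimately have S_bdC: "card (S - boundary C) \<le> a" using Z(2) by linarith
  obtain u where u: "u \<in> C" using regions_meet[OF C(1) C(1)] by blast
  have C_sub: "C \<subseteq> U - Z" using CB C(2) by (auto simp: U_def)
  define K where "K = reach_set E (U - Z) u"
  have uUZ: "u \<in> U - Z" using u C_sub by blast
  have K_sub: "K \<subseteq> U - Z" unfolding K_def using reach_set_subset[OF uUZ] .
  have CK: "C \<subseteq> K" unfolding K_def
    using connected_in_subset_reach_set[OF _ C_sub u] C(1) by (simp add: region_def)
  have K_step: "y \<in> K" if "x \<in> K" "y \<in> U - Z" "E x y" for x y
    using reach_set_step[of x E "U - Z" u y] that K_sub by (auto simp: K_def)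
  have "S - K \<subseteq> (S - boundary C) \<union> Z"
  proof
    fix s assume s: "s \<in> S - K"
    show "s \<in> (S - boundary C) \<union> Z"
    proof (rule ccontr)
      assume "s \<notin> (S - boundary C) \<union> Z"
      then have "s \<in> boundary C" "s \<in> U - Z" using s by (auto simp: U_def)
      then show False using K_step CK s by (auto simp: boundary_def)
    qed
  qed
  then have "card (S - K) \<le> card (S - boundary C) + card Z"
    using card_mono[of "(S - boundary C) \<union> Z" "S - K"] finS finZ card_Un_le[of "S - boundary C" Z] by simp
  then have SK: "card (S - K) \<le> 2 * a" using S_bdC Z(2) by linarith
  \<comment> \<open>The head of an arc with positive capacity lies in \<open>A\<close>, hence in
    \<open>U\<close>, and so can be missed by \<open>K\<close> only if it lies in \<open>Z\<close>.
    The degree bound then limits the arcs leaving \<open>K\<close>.\<close>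
  have "(\<Sum>e\<in>R \<times> R. c e * of_bool (fst e \<in> K \<and> snd e \<notin> K))
      \<le> (\<Sum>e\<in>(SIGMA y:Z. {x \<in> V. E x y}). w)"
  proof -
    let ?D = "{e \<in> R \<times> R. fst e \<in> K \<and> snd e \<notin> K \<and> 0 < c e}"
    have D: "?D \<subseteq> prod.swap ` (SIGMA y:Z. {x \<in> V. E x y})"
    proof
      fix e assume e: "e \<in> ?D"
      obtain x y where xy: "e = (x, y)" by (cases e)
      have mem: "x \<in> R" "y \<in> R" "x \<in> K" "y \<notin> K" "0 < c (x, y)" using e xy by auto
      then have "y \<in> A" using cA by blast
      have "E x y" using mem(5) c_le[of "(x, y)"] by (auto simp: c\<^sub>0_def split: if_splits)
      have "y \<in> Z"
        using K_step[OF mem(3) _ \<open>E x y\<close>] mem(4) \<open>y \<in> A\<close> by (auto simp: U_def)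
      then have "(y, x) \<in> (SIGMA y:Z. {x \<in> V. E x y})" using mem \<open>E x y\<close> by (auto simp: R_def)
      then show "e \<in> prod.swap ` (SIGMA y:Z. {x \<in> V. E x y})" using xy by force
    qed
    have fin: "finite (SIGMA y:Z. {x \<in> V. E x y})" using finZ finV by auto
    have "(\<Sum>e\<in>R \<times> R. c e * of_bool (fst e \<in> K \<and> snd e \<notin> K)) = (\<Sum>e\<in>?D. c e)"
      using finR by (intro sum.mono_neutral_cong_right) auto
    also have "\<dots> \<le> (\<Sum>e\<in>?D. w)"
      by (intro sum_mono c_le_w)
    also have "\<dots> = card ?D * w" by simp
    also have "card ?D \<le> card (SIGMA y:Z. {x \<in> V. E x y})"
      using card_mono[OF finite_imageI[OF fin] D] card_image_le[OF fin, of prod.swap] by linarith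
    finally show ?thesis by simp
  qed
  also have "\<dots> = (\<Sum>y\<in>Z. card {x \<in> V. E x y}) * w"
    using finZ finV by simp
  also have "(\<Sum>y\<in>Z. card {x \<in> V. E x y}) \<le> (\<Sum>y\<in>Z. d)"
    by (rule sum_mono) (use deg Z UV in blast)
  also have "\<dots> \<le> a * d" using Z(2) by simp
  finally have c_cut: "(\<Sum>e\<in>R \<times> R. c e * of_bool (fst e \<in> K \<and> snd e \<notin> K)) \<le> a * d * w" by simp
  \<comment> \<open>With source side \<open>K\<close> at most \<open>2 * a\<close> sources and
    \<open>a * d\<close> arcs are cut, each of capacity at most \<open>w\<close>. The rest of the
    flow is drained inside \<open>K\<close>.\<close>
  have "t * w \<le> cut_value R \<sigma> c A K" by (rule cut)
  also have "\<dots> \<le> w * (2 * a) + a * d * w + card (K \<inter> A \<inter> R)"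
    unfolding cut_value_def sum_\<sigma> sum_of_bool using SK c_cut by (intro add_mono) auto
  also have "card (K \<inter> A \<inter> R) \<le> card K"
    using K_sub UV finV' by (intro card_mono) blast+
  finally have flow_le: "t * w \<le> w * (2 * a) + a * d * w + card K" by simp
  have K_le: "2 * card K \<le> card U" using half[OF uUZ] by (simp add: K_def)
  \<comment> \<open>\<open>K\<close> has at least three quarters of \<open>t * w\<close> vertices,
    yet at most half of \<open>card U\<close>, which exceeds \<open>t * w\<close> by at most
    \<open>card B + card S\<close>. This bounds \<open>t * w\<close> itself.\<close>
  define p where "p = w * (2 * a) + a * d * w"
  have "4 * p = t * w" by (simp add: p_def t_def algebra_simps)
  then have tw_le: "t * w \<le> 2 * card B + 2 * card S"
    using flow_le[folded p_def] K_le card_U by linarith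
  \<comment> \<open>Rounding in the definition of \<open>w\<close> loses less than
    \<open>t\<close>.\<close>
  have "card B\<^sub>1 - card B < t * w + t"
    unfolding w_def using t_pos by (metis dividend_less_times_div add.commute)
  then have "card B\<^sub>1 < 5 * t + 10 * a"
    using tw_le B(2,3) by (simp add: S_def)
  \<comment> \<open>So \<open>B\<^sub>1\<close> is small enough to be deleted whole, which leaves a
    region disjoint from it.\<close>
  then have "card (B\<^sub>1 \<union> boundary B\<^sub>1) \<le> \<theta>"
    using card_Un_le[of B\<^sub>1 "boundary B\<^sub>1"] B\<^sub>1(2) \<theta>_eq by linarith
  moreover have "B\<^sub>1 \<union> boundary B\<^sub>1 \<subseteq> V" using B\<^sub>1(1) boundary_subset by (auto simp: region_def)
  ultimately obtain C' where "region C'" "C' \<inter> (B\<^sub>1 \<union> boundary B\<^sub>1) = {}"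
    using region_avoiding by blast
  then show False using regions_meet[OF \<open>region C'\<close> B\<^sub>1(1)] by blast
qed

section \<open>Cut sets from wirings\<close>

abbreviation adj :: "'a ugraph \<Rightarrow> 'a \<Rightarrow> 'a \<Rightarrow> bool" where
  "adj G u v \<equiv> {u, v} \<in> edges G"

section \<open>Walks, components and cut sets in terms of reachability\<close>

lemma reach_of_successively:
  assumes "successively E xs" "xs \<noteq> []" "set xs \<subseteq> W"
  shows "reach E W (hd xs) (last xs)"
  using assms
proof (induction xs rule: induct_list012)
  case (3 x y zs)
  then have tail: "reach E W y (last (y # zs))" and step: "E x y \<and> x \<in> W \<and> y \<in> W" by auto
  have "reach E W x (last (y # zs))"
    using converse_rtranclp_into_rtranclp[of "\<lambda>x y. E x y \<and> x \<in> W \<and> y \<in> W" x y] step tail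
    unfolding reach_def by blast
  then show ?case by simp
qed (auto simp: reach_def)

lemma walk_of_reach:
  assumes "reach (adj G) (verts G) u v" "u \<in> verts G"
  shows "\<exists>xs. walk G xs \<and> hd xs = u \<and> last xs = v"
  using assms(1) unfolding reach_def
proof (induction rule: rtranclp_induct)
  case base
  have "walk G [u]" using assms(2) by (simp add: walk_def)
  then show ?case by (metis last.simps list.sel(1))
next
  case (step y z)
  then obtain xs where xs: "walk G xs" "hd xs = u" "last xs = y" by blast
  have "z \<in> verts G" "{y, z} \<in> edges G" using step(2) by auto
  with xs have "walk G (xs @ [z])"
    unfolding walk_def by (simp add: successively_append_iff)
  moreover have "hd (xs @ [z]) = u" "last (xs @ [z]) = z"
    using xs by (auto simp: walk_def)
  ultimately show ?case by blast
qed

lemma component_of_vertex_eq_reach_set: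
  "u \<in> verts G \<Longrightarrow> component_of_vertex G u = reach_set (adj G) (verts G) u"
proof (intro equalityI subsetI)
  fix v assume "v \<in> component_of_vertex G u"
  then obtain xs where "walk G xs" "hd xs = u" "last xs = v"
    by (auto simp: component_of_vertex_def)
  then show "v \<in> reach_set (adj G) (verts G) u"
    using reach_of_successively[of "adj G" xs "verts G"] by (auto simp: walk_def reach_set_def)
next
  fix v assume "u \<in> verts G" "v \<in> reach_set (adj G) (verts G) u"
  then show "v \<in> component_of_vertex G u"
    using walk_of_reach[of G u v] by (simp add: component_of_vertex_def reach_set_def)
qed

lemma cut_set_minimum:
  assumes "finite (verts G)"
  obtains S where "cut_set G S" "card S = cut_size G"
proof -
  have "cut_set G (verts G)"
    by (simp add: cut_set_def components_def delete_verts_def)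
  then have "\<exists>S. cut_set G S \<and> card S = card (verts G)" by blast
  then have "\<exists>S. cut_set G S \<and> card S = cut_size G"
    unfolding cut_size_def by (rule LeastI)
  then show ?thesis using that by blast
qed

lemma cut_size_le_sep:
  "H \<in> small_subgraphs X n \<Longrightarrow> cut_size H \<le> sep X n"
  unfolding sep_def by (rule Max_ge[OF finite_cut_sizes imageI])

lemma sep_mono: "m \<le> n \<Longrightarrow> sep X m \<le> sep X n"
  unfolding sep_def
proof (rule Max_mono[OF image_mono _ finite_cut_sizes])
  assume "m \<le> n"
  then show "small_subgraphs X m \<subseteq> small_subgraphs X n" by (auto simp: small_subgraphs_def)
qed (simp add: small_subgraphs_nonempty)

definition induced :: "'a ugraph \<Rightarrow> 'a set \<Rightarrow> 'a ugraph" where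
  "induced G U = \<lparr>verts = U, edges = {e \<in> edges G. e \<subseteq> U}\<rparr>"

lemma simple_graph_edgeE:
  assumes "simple_graph G" "e \<in> edges G"
  obtains u v where "u \<in> verts G" "v \<in> verts G" "u \<noteq> v" "e = {u, v}"
  using assms unfolding simple_graph_def by metis

lemma induced_subgraph:
  assumes "simple_graph G" "U \<subseteq> verts G"
  shows "subgraph (induced G U) G"
proof -
  have "\<exists>u v. u \<in> U \<and> v \<in> U \<and> u \<noteq> v \<and> e = {u, v}" if e: "e \<in> edges G" "e \<subseteq> U" for e
  proof -
    obtain u v where "u \<noteq> v" "e = {u, v}"
      using simple_graph_edgeE[OF assms(1) e(1)] by metis
    then show ?thesis using e(2) by auto
  qed
  then have "simple_graph (induced G U)" by (simp add: simple_graph_def induced_def)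
  moreover have "verts (induced G U) \<subseteq> verts G" "edges (induced G U) \<subseteq> edges G"
    using assms(2) by (auto simp: induced_def)
  ultimately show ?thesis by (simp add: subgraph_def)
qed

text \<open>A minimum cut set of \<open>induced Y U\<close> serves as \<open>Z\<close>, because
  deleting it leaves the adjacency of \<open>Y\<close> unchanged on \<open>U - Z\<close>.\<close>

lemma induced_balanced_separator:
  assumes "simple_graph Y" "U \<subseteq> verts Y" "finite U" "card U \<le> n"
  shows "\<exists>Z\<subseteq>U. card Z \<le> sep Y n \<and> (\<forall>u\<in>U - Z. 2 * card (reach_set (adj Y) (U - Z) u) \<le> card U)"
proof -
  have "induced Y U \<in> small_subgraphs Y n"
    using assms induced_subgraph[of Y U] by (simp add: small_subgraphs_def induced_def)
  then have le: "cut_size (induced Y U) \<le> sep Y n" by (rule cut_size_le_sep)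
  obtain Z where Z: "cut_set (induced Y U) Z" "card Z = cut_size (induced Y U)"
    using cut_set_minimum[of "induced Y U"] assms(3) by (auto simp: induced_def)
  have ZU: "Z \<subseteq> U" using Z(1) by (simp add: cut_set_def induced_def)
  have "2 * card (reach_set (adj Y) (U - Z) u) \<le> card U" if u: "u \<in> U - Z" for u
  proof -
    let ?D = "delete_verts (induced Y U) Z"
    have vD: "verts ?D = U - Z" by (simp add: delete_verts_def induced_def)
    have "reach (adj ?D) (U - Z) = reach (adj Y) (U - Z)"
      unfolding reach_def
      by (rule arg_cong[of _ _ rtranclp]) (auto simp: delete_verts_def induced_def fun_eq_iff)
    then have "component_of_vertex ?D u = reach_set (adj Y) (U - Z) u"
      using component_of_vertex_eq_reach_set[of u ?D] u vD by (simp add: reach_set_def)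
    then have "reach_set (adj Y) (U - Z) u \<in> components ?D"
      using u vD by (auto simp: components_def)
    then have "real (card (reach_set (adj Y) (U - Z) u)) \<le> real (card U) / 2"
      using Z(1) by (simp add: cut_set_def induced_def)
    then show ?thesis by linarith
  qed
  moreover have "card Z \<le> sep Y n" using Z(2) le by linarith
  ultimately show ?thesis using ZU by blast
qed

section \<open>Combinatorics of a coarse wiring\<close>

lemma vertex_point_inject [simp]: "vertex_point v = vertex_point w \<longleftrightarrow> v = w"
proof
  assume "vertex_point v = vertex_point w"
  then have "vertex_point v v = vertex_point w v" by simp
  then show "v = w" by (simp add: vertex_point_def indicator_def split: if_splits)
qed simp

lemma vertex_point_in_cell: "vertex_point w \<in> cell e \<Longrightarrow> w \<in> e"
  by (auto simp: cell_def vertex_point_def)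

text \<open>A cell contains no vertex points besides its ends, so the vertices of a walk can be
  recovered from the topological image of an edge.\<close>

lemma vertex_point_in_walk_trace: "vertex_point w \<in> walk_trace xs \<longleftrightarrow> w \<in> set xs"
proof
  assume "vertex_point w \<in> walk_trace xs"
  then consider "w \<in> set xs" | i where "Suc i < length xs" "vertex_point w \<in> cell {xs ! i, xs ! Suc i}"
    by (auto simp: walk_trace_def)
  then show "w \<in> set xs"
  proof cases
    case 2
    then have "w \<in> {xs ! i, xs ! Suc i}" using vertex_point_in_cell by metis
    then show ?thesis using 2(1) nth_mem[of i xs] nth_mem[of "Suc i" xs] by auto
  qed
qed (auto simp: walk_trace_def)

locale finite_coarse_wiring =
  fixes k :: nat and G :: "'a ugraph" and Y :: "'b ugraph" and f :: "('a \<Rightarrow> real) \<Rightarrow> ('b \<Rightarrow> real)"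
  assumes finG: "finite (verts G)" and simpleG: "simple_graph G"
    and coarse: "coarse_wiring k G Y f"
begin

definition vmap :: "'a \<Rightarrow> 'b" where
  "vmap v = (SOME w. w \<in> verts Y \<and> f (vertex_point v) = vertex_point w)"

definition image_verts :: "'b set" where
  "image_verts = verts (wiring_image G Y f)"

lemma vmap: "v \<in> verts G \<Longrightarrow> vmap v \<in> verts Y \<and> f (vertex_point v) = vertex_point (vmap v)"
  unfolding vmap_def
  by (rule someI_ex) (use coarse in \<open>auto simp: coarse_wiring_def wiring_def\<close>)

lemma vmap_image: "v \<in> verts G \<Longrightarrow> vmap v \<in> image_verts"
  unfolding image_verts_def wiring_image_def using vmap by auto

lemma fibre_card: "w \<in> verts Y \<Longrightarrow> card {v \<in> verts G. vmap v = w} \<le> k"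
proof -
  assume w: "w \<in> verts Y"
  have "{v \<in> verts G. vmap v = w} = {v \<in> verts G. f (vertex_point v) = vertex_point w}"
    using vmap by auto
  then show ?thesis using coarse w by (simp add: coarse_wiring_def)
qed

lemma edge_walk:
  assumes "e \<in> edges G"
  obtains u v xs where "e = {u, v}" "u \<in> verts G" "v \<in> verts G" "walk Y xs"
    "hd xs = vmap u" "last xs = vmap v" "f ` cell e = walk_trace xs"
proof -
  obtain u v xs where *: "e = {u, v}" "walk Y xs"
    "vertex_point (hd xs) = f (vertex_point u)" "vertex_point (last xs) = f (vertex_point v)"
    "f ` cell e = walk_trace xs"
    using coarse assms unfolding coarse_wiring_def wiring_def by meson
  moreover have "e \<subseteq> verts G" using simple_graph_edgeE[OF simpleG assms] by auto
  then have "u \<in> verts G" "v \<in> verts G" using *(1) by auto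
  ultimately show ?thesis using that[of u v xs] vmap by simp
qed

lemma finite_edges: "finite (edges G)"
proof (rule finite_subset)
  show "edges G \<subseteq> Pow (verts G)"
  proof
    fix e assume "e \<in> edges G"
    then show "e \<in> Pow (verts G)" using simple_graph_edgeE[OF simpleG, of e] by auto
  qed
qed (use finG in simp)

lemma finite_image_verts: "finite image_verts"
proof (rule finite_subset)
  show "image_verts \<subseteq> vmap ` verts G \<union> (\<Union>e\<in>edges G. {w. vertex_point w \<in> f ` cell e})"
    unfolding image_verts_def wiring_image_def using vmap by fastforce
  have "finite {w. vertex_point w \<in> f ` cell e}" if e: "e \<in> edges G" for e
  proof -
    obtain u v xs where "f ` cell e = walk_trace xs" using edge_walk[OF e] by metis
    then have "{w. vertex_point w \<in> f ` cell e} = set xs" by (simp add: vertex_point_in_walk_trace)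
    then show ?thesis by simp
  qed
  then show "finite (vmap ` verts G \<union> (\<Union>e\<in>edges G. {w. vertex_point w \<in> f ` cell e}))"
    using finG finite_edges by blast
qed

lemma image_verts_subset: "image_verts \<subseteq> verts Y"
  by (auto simp: image_verts_def wiring_image_def)

lemma walk_image_verts:
  assumes "e \<in> edges G" "walk Y xs" "f ` cell e = walk_trace xs"
  shows "set xs \<subseteq> image_verts"
proof
  fix w assume "w \<in> set xs"
  then have "w \<in> verts Y" "vertex_point w \<in> f ` cell e"
    using assms(2,3) vertex_point_in_walk_trace[of w xs] by (auto simp: walk_def)
  then show "w \<in> image_verts"
    unfolding image_verts_def wiring_image_def using assms(1) by simp blast
qed

lemma sum_fibres:
  assumes "finite B"
  shows "(\<Sum>w\<in>B. card {v \<in> verts G. vmap v = w}) = card {v \<in> verts G. vmap v \<in> B}"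
proof -
  have "{v \<in> verts G. vmap v \<in> B} = (\<Union>w\<in>B. {v \<in> verts G. vmap v = w})" by auto
  then show ?thesis
    using assms finG by (subst card_UN_disjoint[symmetric]) auto
qed

text \<open>Each image vertex carries at most \<open>k\<close> vertices of \<open>G\<close>. This
  linear bound later supplies the condition \<open>x \<le> y\<close> of the inversion
  lemmas.\<close>

lemma card_verts_le: "card (verts G) \<le> k * wiring_volume G Y f"
proof -
  have "{v \<in> verts G. vmap v \<in> image_verts} = verts G" using vmap_image by auto
  then have "card (verts G) = (\<Sum>w\<in>image_verts. card {v \<in> verts G. vmap v = w})"
    using sum_fibres[OF finite_image_verts] by simp
  also have "\<dots> \<le> (\<Sum>w\<in>image_verts. k)"
    by (rule sum_mono) (use fibre_card image_verts_subset in blast)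
  finally show ?thesis by (simp add: wiring_volume_def image_verts_def mult.commute)
qed

text \<open>The image is separated with fibre sizes as weights. Pulling back, each separator vertex
  costs at most \<open>k\<close> vertices above it and at most \<open>d * k\<close> edges whose
  images use one of its edges, whence the factor \<open>k * (1 + d)\<close>.\<close>

lemma cut_size_le:
  assumes sY: "simple_graph Y"
    and degY: "\<And>v. v \<in> verts Y \<Longrightarrow> finite {e \<in> edges Y. v \<in> e} \<and> card {e \<in> edges Y. v \<in> e} \<le> d"
    and vol: "wiring_volume G Y f \<le> n"
  shows "cut_size G \<le> k * (1 + d) * (24 * d + 58) * max 1 (sep Y n)"
proof -
  \<comment> \<open>The weighted separator theorem requires a positive bound, hence the maximum with
    1.\<close>
  define a where "a = max 1 (sep Y n)"
  define \<mu> where "\<mu> w = card {v \<in> verts G. vmap v = w}" for w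
  let ?V = image_verts
  have card_V: "card ?V \<le> n" using vol by (simp add: wiring_volume_def image_verts_def)
  have deg: "card {u \<in> ?V. adj Y u v} \<le> d" if "v \<in> ?V" for v
  proof -
    have v: "v \<in> verts Y" using that image_verts_subset by blast
    have "inj_on (\<lambda>u. {u, v}) {u \<in> ?V. adj Y u v}"
      by (auto simp: inj_on_def doubleton_eq_iff)
    moreover have "(\<lambda>u. {u, v}) ` {u \<in> ?V. adj Y u v} \<subseteq> {e \<in> edges Y. v \<in> e}" by auto
    ultimately have "card {u \<in> ?V. adj Y u v} \<le> card {e \<in> edges Y. v \<in> e}"
      using degY[OF v] card_inj_on_le by blast
    then show ?thesis using degY[OF v] by linarith
  qed
  have bal: "\<exists>Z\<subseteq>U. card Z \<le> a \<and> (\<forall>u\<in>U - Z. 2 * card (reach_set (adj Y) (U - Z) u) \<le> card U)"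
    if "U \<subseteq> ?V" for U
  proof -
    have "card U \<le> n" using card_mono[OF finite_image_verts that] card_V by linarith
    then have "\<exists>Z\<subseteq>U. card Z \<le> sep Y n
        \<and> (\<forall>u\<in>U - Z. 2 * card (reach_set (adj Y) (U - Z) u) \<le> card U)"
      using that image_verts_subset finite_image_verts finite_subset
      by (intro induced_balanced_separator[OF sY]) blast+
    moreover have "sep Y n \<le> a" by (simp add: a_def)
    ultimately show ?thesis using order.trans by blast
  qed
  have sym: "symp (adj Y)" by (simp add: symp_def insert_commute)
  have "0 < a" by (simp add: a_def)
  with sym have "\<exists>S\<subseteq>?V. card S \<le> (24 * d + 58) * a
      \<and> (\<forall>w\<in>?V - S. 2 * sum \<mu> (reach_set (adj Y) (?V - S) w) \<le> sum \<mu> ?V)"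
    using finite_image_verts deg bal by (intro balanced_weighted_separator) auto
  then obtain S where S: "S \<subseteq> ?V" "card S \<le> (24 * d + 58) * a"
    and light: "\<And>w. w \<in> ?V - S \<Longrightarrow> 2 * sum \<mu> (reach_set (adj Y) (?V - S) w) \<le> sum \<mu> ?V"
    by blast
  have finS: "finite S" using S finite_image_verts finite_subset by blast
  define through where
    "through w = (\<Union>e'\<in>{e' \<in> edges Y. w \<in> e'}. {e \<in> edges G. cell e' \<subseteq> f ` cell e})" for w
  have card_through: "card (through w) \<le> d * k" if "w \<in> S" for w
  proof -
    have w: "w \<in> verts Y" using that S image_verts_subset by blast
    have "card (through w) \<le> (\<Sum>e'\<in>{e' \<in> edges Y. w \<in> e'}. card {e \<in> edges G. cell e' \<subseteq> f ` cell e})"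
      unfolding through_def using degY[OF w] by (intro card_UN_le) blast
    also have "\<dots> \<le> (\<Sum>e'\<in>{e' \<in> edges Y. w \<in> e'}. k)"
      by (rule sum_mono) (use coarse in \<open>auto simp: coarse_wiring_def\<close>)
    also have "\<dots> \<le> d * k" using degY[OF w] by simp
    finally show ?thesis .
  qed
  define end1 where "end1 e = (SOME v. v \<in> e)" for e :: "'a set"
  have end1: "end1 e \<in> e" "end1 e \<in> verts G" if eG: "e \<in> edges G" for e
  proof -
    obtain u v where e: "u \<in> verts G" "v \<in> verts G" "e = {u, v}"
      using simple_graph_edgeE[OF simpleG eG] by metis
    then show "end1 e \<in> e" unfolding end1_def by (metis insertI1 someI)
    then show "end1 e \<in> verts G" using e by auto
  qed
  \<comment> \<open>Besides the vertices over \<open>S\<close>, one endpoint of each edge whose image runs through \<open>S\<close>.\<close>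
  define T where "T = {v \<in> verts G. vmap v \<in> S} \<union> end1 ` (\<Union>w\<in>S. through w)"
  have through_sub: "through w \<subseteq> edges G" for w by (auto simp: through_def)
  have T_sub: "T \<subseteq> verts G" unfolding T_def using end1 through_sub by blast
  have fin_through: "finite (\<Union>w\<in>S. through w)"
    using finite_subset[OF _ finite_edges, of "\<Union>w\<in>S. through w"] through_sub by blast
  have "card {v \<in> verts G. vmap v \<in> S} \<le> card S * k"
  proof -
    have "card {v \<in> verts G. vmap v \<in> S} \<le> (\<Sum>w\<in>S. k)"
      unfolding sum_fibres[OF finS, symmetric]
      by (rule sum_mono) (use fibre_card S image_verts_subset in blast)
    then show ?thesis by simp
  qed
  moreover have "card (end1 ` (\<Union>w\<in>S. through w)) \<le> card S * (d * k)"
  proof -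
    have "card (end1 ` (\<Union>w\<in>S. through w)) \<le> card (\<Union>w\<in>S. through w)"
      using fin_through by (rule card_image_le)
    also have "\<dots> \<le> (\<Sum>w\<in>S. card (through w))" using finS by (rule card_UN_le)
    also have "\<dots> \<le> (\<Sum>w\<in>S. d * k)" by (rule sum_mono) (rule card_through)
    finally show ?thesis by simp
  qed
  ultimately have "card T \<le> card S * k + card S * (d * k)"
    unfolding T_def
    using card_Un_le[of "{v \<in> verts G. vmap v \<in> S}" "end1 ` (\<Union>w\<in>S. through w)"] by linarith
  also have "\<dots> = k * (1 + d) * card S" by (simp add: algebra_simps)
  also have "\<dots> \<le> k * (1 + d) * ((24 * d + 58) * a)" using S(2) by (rule mult_le_mono2)
  finally have card_T: "card T \<le> k * (1 + d) * (24 * d + 58) * a" by (simp only: mult.assoc)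

  let ?D = "delete_verts G T"
  have vD: "verts ?D = verts G - T" by (simp add: delete_verts_def)
  have reach_image: "reach (adj Y) (?V - S) (vmap x) (vmap y)" if "adj ?D x y" for x y
  proof -
    have e: "{x, y} \<in> edges G" "{x, y} \<inter> T = {}" using that by (auto simp: delete_verts_def)
    obtain u v xs where uv: "{x, y} = {u, v}" "u \<in> verts G" "v \<in> verts G" "walk Y xs"
      "hd xs = vmap u" "last xs = vmap v" "f ` cell {x, y} = walk_trace xs"
      using edge_walk[OF e(1)] by metis
    have xs: "xs \<noteq> []" "successively (adj Y) xs" using uv(4) by (auto simp: walk_def)
    have not_through: "{x, y} \<notin> through w" if "w \<in> S" for w
    proof
      assume "{x, y} \<in> through w"
      then have "end1 {x, y} \<in> T" using that unfolding T_def by blast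
      then show False using end1(1)[OF e(1)] e(2) by blast
    qed
    have edge_avoids: "xs ! i \<notin> S \<and> xs ! Suc i \<notin> S" if i: "Suc i < length xs" for i
    proof -
      have "{xs ! i, xs ! Suc i} \<in> edges Y"
        using xs(2) i by (simp add: successively_conv_nth)
      moreover have "cell {xs ! i, xs ! Suc i} \<subseteq> f ` cell {x, y}"
        unfolding uv(7) walk_trace_def using i by blast
      ultimately have "{x, y} \<in> through w" if "w \<in> {xs ! i, xs ! Suc i}" for w
        unfolding through_def using e(1) that by blast
      then show ?thesis using not_through by blast
    qed
    \<comment> \<open>A walk of length zero has no edge for \<open>through\<close> to detect; its
      only vertex is \<open>vmap u\<close>, where \<open>u\<close> is outside
      \<open>T\<close>.\<close>
    have "w \<notin> S" if w: "w \<in> set xs" for w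
    proof -
      obtain i where i: "i < length xs" "w = xs ! i" using w by (metis in_set_conv_nth)
      show ?thesis
      proof (cases i)
        case 0
        show ?thesis
        proof (cases "Suc 0 < length xs")
          case False
          then have "w = vmap u" using 0 i(2) uv(5) xs(1) by (simp add: hd_conv_nth)
          moreover have "u \<notin> T" using uv(1) e(2) by auto
          ultimately show ?thesis using uv(2) by (simp add: T_def)
        qed (use 0 i edge_avoids[of 0] in simp)
      qed (use i edge_avoids in simp)
    qed
    then have "set xs \<subseteq> ?V - S" using walk_image_verts[OF e(1) uv(4,7)] by blast
    then have "reach (adj Y) (?V - S) (vmap u) (vmap v)"
      using reach_of_successively[OF xs(2,1)] uv(5,6) by simp
    moreover from this have "reach (adj Y) (?V - S) (vmap v) (vmap u)"
      using reach_sym[OF sym] by blast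
    ultimately show ?thesis using uv(1) by (auto simp: doubleton_eq_iff)
  qed
  \<comment> \<open>A component of \<open>G\<close> without \<open>T\<close> maps into one component
    of the image without \<open>S\<close>, so its size is at most the weight of that
    component.\<close>
  have "real (card K) \<le> real (card (verts G)) / 2" if K: "K \<in> components ?D" for K
  proof -
    obtain x where x: "x \<in> verts G - T" "K = reach_set (adj ?D) (verts G - T) x"
      using K component_of_vertex_eq_reach_set[of _ ?D] vD by (auto simp: components_def)
    let ?W = "reach_set (adj Y) (?V - S) (vmap x)"
    have x_in: "vmap x \<in> ?V - S" using x(1) vmap_image by (auto simp: T_def)
    have finW: "finite ?W"
      using reach_set_subset[OF x_in, of "adj Y"] finite_image_verts finite_subset by blast
    have "vmap y \<in> ?W" if "y \<in> K" for y
    proof -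
      have "reach (adj ?D) (verts G - T) x y" using that x(2) by (simp add: reach_set_def)
      then have "reach (adj Y) (?V - S) (vmap x) (vmap y)"
        unfolding reach_def[of "adj ?D"]
      proof (induction rule: rtranclp_induct)
        case base
        show ?case by (simp add: reach_def)
      next
        case (step y z)
        then show ?case using reach_image[of y z] by (blast intro: reach_trans)
      qed
      then show ?thesis by (simp add: reach_set_def)
    qed
    then have "K \<subseteq> {v \<in> verts G. vmap v \<in> ?W}"
      using reach_set_subset[OF x(1), of "adj ?D"] x(2) by blast
    then have "card K \<le> sum \<mu> ?W"
      unfolding \<mu>_def sum_fibres[OF finW] using finG by (intro card_mono) auto
    moreover have "{v \<in> verts G. vmap v \<in> ?V} = verts G" using vmap_image by auto
    then have "sum \<mu> ?V = card (verts G)"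
      unfolding \<mu>_def sum_fibres[OF finite_image_verts] by simp
    ultimately show ?thesis using light[OF x_in] by linarith
  qed
  then have "cut_set G T" using T_sub by (simp add: cut_set_def)
  then have "cut_size G \<le> card T"
    unfolding cut_size_def by (intro Least_le) blast
  then show ?thesis using card_T by (simp add: a_def)
qed

end

section \<open>From single wirings to profiles\<close>

text \<open>A finite infimum excludes the empty family, and a nonempty set of extended naturals
  attains its infimum.\<close>

lemma wiring_of_finite_wir:
  assumes "wir k G Y \<le> enat n"
  obtains f where "coarse_wiring k G Y f" "wiring_volume G Y f \<le> n"
proof -
  let ?W = "(\<lambda>f. enat (wiring_volume G Y f)) ` {f. coarse_wiring k G Y f}"
  have inf: "Inf ?W \<le> enat n" using assms by (simp add: wir_def)
  then have "Inf ?W \<noteq> \<infinity>" using enat_ord_simps(5) by (metis enat_ile enat.distinct(2))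
  then have "?W \<noteq> {}" unfolding Inf_enat_def by meson
  then obtain x where "x \<in> ?W" by blast
  then have "Inf ?W \<in> ?W" unfolding Inf_enat_def using LeastI[of "\<lambda>x. x \<in> ?W" x] by auto
  then obtain f where "coarse_wiring k G Y f" "Inf ?W = enat (wiring_volume G Y f)" by auto
  then show ?thesis using that inf by simp
qed

lemma wir_profile_bounds:
  fixes X :: "'a ugraph" and Y :: "'b ugraph"
  assumes "simple_graph X" "infinite (verts X)" "simple_graph Y" "bounded_degree Y"
  obtains L where "0 < L"
    "\<And>m n. wir_profile k X Y m = enat n \<Longrightarrow> sep X m \<le> L * max 1 (sep Y n) \<and> m \<le> k * n"
proof -
  obtain d where d: "\<And>v. v \<in> verts Y \<Longrightarrow>
      finite {e \<in> edges Y. v \<in> e} \<and> card {e \<in> edges Y. v \<in> e} \<le> d"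
    using assms(4) by (auto simp: bounded_degree_def)
  \<comment> \<open>The summand 1 keeps \<open>L\<close> positive for \<open>k = 0\<close>.\<close>
  define L where "L = k * (1 + d) * (24 * d + 58) + 1"
  have "sep X m \<le> L * max 1 (sep Y n) \<and> m \<le> k * n" if eq: "wir_profile k X Y m = enat n" for m n
  proof -
    have wiring: "\<exists>f. finite_coarse_wiring k G Y f \<and> wiring_volume G Y f \<le> n"
      if G: "G \<in> small_subgraphs X m" for G
    proof -
      have "wir k G Y \<le> enat n"
        using G eq unfolding wir_profile_def by (metis SUP_upper)
      then obtain f where "coarse_wiring k G Y f" "wiring_volume G Y f \<le> n"
        using wiring_of_finite_wir by blast
      then show ?thesis
        using G by (auto simp: finite_coarse_wiring_def small_subgraphs_def subgraph_def)
    qed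
    have "cut_size G \<le> L * max 1 (sep Y n)" if G: "G \<in> small_subgraphs X m" for G
    proof -
      obtain f where "finite_coarse_wiring k G Y f \<and> wiring_volume G Y f \<le> n"
        using wiring[OF G] by blast
      then have "cut_size G \<le> k * (1 + d) * (24 * d + 58) * max 1 (sep Y n)"
        using finite_coarse_wiring.cut_size_le[of k G Y f d n, OF _ assms(3) d] by blast
      also have "\<dots> \<le> L * max 1 (sep Y n)" by (simp add: L_def)
      finally show ?thesis .
    qed
    then have "sep X m \<le> L * max 1 (sep Y n)"
      unfolding sep_def[of X]
      by (intro Max.boundedI finite_cut_sizes) (auto simp: small_subgraphs_nonempty)
    moreover obtain U where U: "U \<subseteq> verts X" "finite U" "card U = m"
      using assms(2) infinite_arbitrarily_large by metis
    then have "induced X U \<in> small_subgraphs X m"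
      using induced_subgraph[OF assms(1)] by (simp add: small_subgraphs_def) (simp add: induced_def)
    from wiring[OF this] obtain f
      where f: "finite_coarse_wiring k (induced X U) Y f" "wiring_volume (induced X U) Y f \<le> n" by blast
    have "m \<le> k * wiring_volume (induced X U) Y f"
      using finite_coarse_wiring.card_verts_le[OF f(1)] U(3) by (simp add: induced_def)
    then have "m \<le> k * n" using f(2) by (meson mult_le_mono2 order.trans)
    ultimately show ?thesis by simp
  qed
  then show ?thesis using that[of L] by (simp add: L_def)
qed

lemma wir_profile_mono: "m \<le> n \<Longrightarrow> wir_profile k X Y m \<le> wir_profile k X Y n"
  unfolding wir_profile_def by (rule SUP_subset_mono) (auto simp: small_subgraphs_def)

section \<open>Asymptotic inversion\<close>

lemma powr_ln_dominates:
  fixes a b :: real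
  assumes "0 < a"
  shows "\<forall>\<^sub>F x in at_top. c \<le> x powr a * ln x powr b"
proof -
  have "filterlim (\<lambda>x::real. x powr a * ln x powr b) at_top at_top"
    using assms by real_asymp
  then show ?thesis by (simp add: filterlim_at_top)
qed

text \<open>If \<open>y\<close> exceeds a fixed power of \<open>x\<close>, the claim is immediate.
  Otherwise \<open>ln x\<close> and \<open>ln y\<close> agree up to a constant factor, so
  \<open>ln y\<close> can be replaced by \<open>ln x\<close> and a \<open>p\<close>-th root
  taken.\<close>

lemma polynomial_inversion:
  fixes r p s q L :: real
  assumes "0 < p" "0 \<le> r" "0 < L"
  obtains K x\<^sub>0 where "0 < K" "\<And>x y. x\<^sub>0 \<le> x \<Longrightarrow> x \<le> y \<Longrightarrow>
     x powr r * ln x powr s \<le> L * (y powr p * ln y powr q + 1) \<Longrightarrow>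
     x powr (r / p) * ln x powr ((s - q) / p) \<le> K * y"
proof -
  \<comment> \<open>One power of \<open>x\<close> beyond \<open>r / p\<close> absorbs the
    logarithmic factor.\<close>
  define A where "A = r / p + 1"
  have "1 \<le> A" using assms divide_nonneg_pos[of r p] by (simp add: A_def)
  then have "0 < A" by simp
  define K\<^sub>0 where "K\<^sub>0 = 2 * L * A powr \<bar>q\<bar>"
  define K where "K = max 1 (K\<^sub>0 powr (1 / p))"
  have K\<^sub>0: "0 < K\<^sub>0" using assms \<open>0 < A\<close> by (simp add: K\<^sub>0_def)
  have "\<forall>\<^sub>F x in at_top. 1 \<le> x powr p * ln x powr q"
    using powr_ln_dominates[OF assms(1)] .
  moreover have "\<forall>\<^sub>F x::real in at_top. ln x powr ((s - q) / p) \<le> x"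
    by real_asymp
  moreover have "\<forall>\<^sub>F x::real in at_top. exp 1 \<le> x" by (rule eventually_ge_at_top)
  ultimately have "\<forall>\<^sub>F x in at_top. 1 \<le> x powr p * ln x powr q
      \<and> ln x powr ((s - q) / p) \<le> x \<and> exp 1 \<le> x"
    by eventually_elim auto
  then obtain x\<^sub>0 where x\<^sub>0: "\<And>x. x\<^sub>0 \<le> x \<Longrightarrow> 1 \<le> x powr p * ln x powr q
      \<and> ln x powr ((s - q) / p) \<le> x \<and> exp 1 \<le> x"
    unfolding eventually_at_top_linorder by blast
  have "x powr (r / p) * ln x powr ((s - q) / p) \<le> K * y"
    if x: "x\<^sub>0 \<le> x" "x \<le> y" and le: "x powr r * ln x powr s \<le> L * (y powr p * ln y powr q + 1)" for x y
  proof -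
    have e: "exp 1 \<le> x" using x\<^sub>0[OF x(1)] by simp
    then have x1: "1 \<le> x" using exp_ge_add_one_self[of 1] by linarith
    have lnx: "1 \<le> ln x" using e x1 by (simp add: ln_ge_iff)
    have lnxy: "ln x \<le> ln y" using x1 x(2) by simp
    have y: "0 < y" using x1 x(2) by linarith
    show ?thesis
    proof (cases "x powr A \<le> y")
      case True
      have "x powr (r / p) * ln x powr ((s - q) / p) \<le> x powr (r / p) * x"
        using x\<^sub>0[OF x(1)] by (intro mult_left_mono) auto
      also have "\<dots> = x powr A" using x1 by (simp add: A_def powr_add)
      also have "\<dots> \<le> y" by (rule True)
      also have "y \<le> K * y" using y by (simp add: K_def)
      finally show ?thesis .
    next
      case False
      then have "ln y < ln (x powr A)" using y x1 by (subst ln_less_cancel_iff) auto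
      then have lnyA: "ln y \<le> A * ln x" using x1 by (simp add: ln_powr)
      \<comment> \<open>For \<open>q \<ge> 0\<close> this rests on the upper bound for
        \<open>ln y\<close>, for negative \<open>q\<close> on \<open>ln x \<le> ln y\<close>; the
        exponent \<open>\<bar>q\<bar>\<close> gives one constant for both.\<close>
      have lny: "ln y powr q \<le> A powr \<bar>q\<bar> * ln x powr q"
      proof (cases "0 \<le> q")
        case True
        have "ln y powr q \<le> (A * ln x) powr q"
          using lnyA lnx lnxy True by (intro powr_mono2) auto
        then show ?thesis using True \<open>0 < A\<close> lnx by (simp add: powr_mult)
      next
        case False
        have "ln y powr q \<le> ln x powr q"
          using lnxy lnx False by (intro powr_mono2') auto
        also have "\<dots> \<le> A powr \<bar>q\<bar> * ln x powr q"
          using mult_right_mono[OF ge_one_powr_ge_zero[OF \<open>1 \<le> A\<close>, of "\<bar>q\<bar>"], of "ln x powr q"]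
          by simp
        finally show ?thesis .
      qed
      have "x powr r * ln x powr s \<le> L * (y powr p * ln y powr q + 1)" by (rule le)
      also have "\<dots> \<le> L * (2 * (y powr p * ln y powr q))"
        using x\<^sub>0[of y] x assms(3) by (intro mult_left_mono) auto
      also have "\<dots> \<le> L * (2 * (y powr p * (A powr \<bar>q\<bar> * ln x powr q)))"
        using lny assms(3) by (intro mult_left_mono) auto
      finally have "x powr r * ln x powr s \<le> K\<^sub>0 * y powr p * ln x powr q"
        by (simp add: K\<^sub>0_def mult_ac)
      then have "x powr r * ln x powr s / ln x powr q \<le> K\<^sub>0 * y powr p"
        using lnx by (simp add: pos_divide_le_eq)
      then have *: "x powr r * ln x powr (s - q) \<le> K\<^sub>0 * y powr p"
        by (simp add: powr_diff)
      have "(x powr r * ln x powr (s - q)) powr (1 / p) \<le> (K\<^sub>0 * y powr p) powr (1 / p)"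
        using * assms(1) by (intro powr_mono2) auto
      then have "x powr (r / p) * ln x powr ((s - q) / p) \<le> K\<^sub>0 powr (1 / p) * y"
        using x1 lnx K\<^sub>0 y assms(1) by (simp add: powr_mult powr_powr)
      also have "\<dots> \<le> K * y" using y by (intro mult_right_mono) (auto simp: K_def)
      finally show ?thesis .
    qed
  qed
  moreover have "0 < K" by (simp add: K_def)
  ultimately show ?thesis using that by blast
qed

text \<open>A constant factor cannot be left inside the exponential. Passing from exponent
  \<open>q\<close> to \<open>q + 1\<close> gains a factor \<open>ln y\<close>, which absorbs
  \<open>L\<close>; since \<open>q + 1 > 0\<close>, the additive constant is absorbed as well and
  the root can be taken.\<close>

lemma exponential_inversion:
  fixes r s q L :: real
  assumes "-1 < q" "0 < L"
  obtains x\<^sub>0 where "\<And>x y. x\<^sub>0 \<le> x \<Longrightarrow> x \<le> y \<Longrightarrow>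
     x powr r * ln x powr s \<le> L * (ln y powr q + 1) \<Longrightarrow>
     exp (x powr (r / (q + 1)) * ln x powr (s / (q + 1))) \<le> y"
proof -
  have "filterlim (\<lambda>y::real. ln y powr (q + 1)) at_top at_top"
    using assms by real_asymp
  then have "\<forall>\<^sub>F y::real in at_top. 2 * L \<le> ln y powr (q + 1)"
    by (simp add: filterlim_at_top)
  moreover have "\<forall>\<^sub>F y::real in at_top. 2 * L \<le> ln y"
    using ln_at_top by (simp add: filterlim_at_top)
  ultimately have "\<forall>\<^sub>F y::real in at_top. L * (ln y powr q + 1) \<le> ln y powr (q + 1)"
  proof eventually_elim
    case (elim y)
    have "2 * L * ln y powr q \<le> ln y * ln y powr q"
      using elim(2) by (intro mult_right_mono) auto
    also have "\<dots> = ln y powr (q + 1)"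
      using elim(2) assms(2) by (simp add: powr_add)
    finally show ?case using elim(1) by (simp add: distrib_left)
  qed
  moreover have "\<forall>\<^sub>F x::real in at_top. exp 1 \<le> x" by (rule eventually_ge_at_top)
  ultimately have "\<forall>\<^sub>F y in at_top. L * (ln y powr q + 1) \<le> ln y powr (q + 1) \<and> exp 1 \<le> y"
    by eventually_elim auto
  then obtain x\<^sub>0 where x\<^sub>0: "\<And>y. x\<^sub>0 \<le> y \<Longrightarrow> L * (ln y powr q + 1) \<le> ln y powr (q + 1) \<and> exp 1 \<le> y"
    unfolding eventually_at_top_linorder by blast
  have "exp (x powr (r / (q + 1)) * ln x powr (s / (q + 1))) \<le> y"
    if x: "x\<^sub>0 \<le> x" "x \<le> y" and le: "x powr r * ln x powr s \<le> L * (ln y powr q + 1)" for x y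
  proof -
    have "exp 1 \<le> x" using x\<^sub>0[OF x(1)] by simp
    then have x1: "1 \<le> x" using exp_ge_add_one_self[of 1] by linarith
    have lnx: "0 \<le> ln x" and lny: "0 \<le> ln y" and y: "0 < y" using x1 x(2) by auto
    have "x powr r * ln x powr s \<le> ln y powr (q + 1)"
      using x\<^sub>0[of y] x le by linarith
    then have "(x powr r * ln x powr s) powr (1 / (q + 1)) \<le> (ln y powr (q + 1)) powr (1 / (q + 1))"
      using assms(1) by (intro powr_mono2) auto
    then have "x powr (r / (q + 1)) * ln x powr (s / (q + 1)) \<le> ln y"
      using x1 lnx lny assms(1) by (simp add: powr_mult powr_powr)
    then have "exp (x powr (r / (q + 1)) * ln x powr (s / (q + 1))) \<le> exp (ln y)" by simp
    then show ?thesis using y by simp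
  qed
  then show ?thesis using that by blast
qed

section \<open>Lower bounds for wiring profiles\<close>

lemma lesssim_ereal_iff:
  "(\<lambda>n. ereal (f n)) \<lesssim> (\<lambda>n. ereal (g n)) \<longleftrightarrow> (\<exists>C::nat. \<forall>n. f n \<le> real C * g (C * n) + real C)"
  by (simp add: lesssim_def)

text \<open>Only finite values of \<open>h\<close> need an estimate. The finitely many arguments
  below \<open>n\<^sub>0\<close> go into the additive constant, and monotonicity allows the factor
  \<open>c\<close> in the argument to grow to the common constant.\<close>

lemma lesssim_ereal_of_enatI:
  fixes f :: "nat \<Rightarrow> real" and h :: "nat \<Rightarrow> enat"
  assumes mono: "\<And>m n. m \<le> n \<Longrightarrow> h m \<le> h n"
    and le: "\<And>n N. n\<^sub>0 \<le> n \<Longrightarrow> h (c * n) = enat N \<Longrightarrow> f n \<le> K * real N"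
  shows "(\<lambda>n. ereal (f n)) \<lesssim> (\<lambda>n. ereal_of_enat (h n))"
proof -
  define M where "M = (\<Sum>i<n\<^sub>0. \<bar>f i\<bar>)"
  \<comment> \<open>The summand 1 makes \<open>C\<close> positive, since in \<open>ereal\<close>
    zero times infinity is zero.\<close>
  define C where "C = c + nat \<lceil>K\<rceil> + nat \<lceil>M\<rceil> + 1"
  have C: "c \<le> C" "K \<le> real C" "M \<le> real C" "0 < C"
    unfolding C_def by linarith+
  have "ereal (f n) \<le> ereal (real C) * ereal_of_enat (h (C * n)) + ereal (real C)" for n
  proof (cases "h (C * n)")
    case (enat N)
    have "f n \<le> real C * real N + real C"
    proof (cases "n\<^sub>0 \<le> n")
      case True
      have "h (c * n) \<le> enat N" using mono[of "c * n" "C * n"] C(1) enat by simp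
      then obtain N' where N': "h (c * n) = enat N'" "N' \<le> N"
        by (metis enat_ile enat_ord_simps(1))
      have "f n \<le> K * real N'" using le[OF True N'(1)] .
      also have "\<dots> \<le> real C * real N'" using C(2) by (intro mult_right_mono) auto
      also have "\<dots> \<le> real C * real N" using N'(2) by (intro mult_left_mono) auto
      finally show ?thesis by simp
    next
      case False
      then have "\<bar>f n\<bar> \<le> M" unfolding M_def by (intro member_le_sum) auto
      then show ?thesis using C(3) mult_nonneg_nonneg[of "real C" "real N"] by linarith
    qed
    then show ?thesis using enat by simp
  next
    case infinity
    then show ?thesis using C(4) by simp
  qed
  then show ?thesis unfolding lesssim_def by blast
qed

theorem theorem1p17:
  fixes X :: "'a ugraph" and Y :: "'b ugraph" and r p s q :: real and k :: nat
  assumes "simple_graph X" and "bounded_degree X" and "infinite (verts X)"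
    and "simple_graph Y" and "bounded_degree Y"
    and "r \<ge> 0" and "p \<ge> 0"
    and "p = 0 \<longrightarrow> q > -1"
    and "(\<lambda>n. ereal (real n powr r * ln (real n) powr s)) \<lesssim> (\<lambda>n. ereal (real (sep X n)))"
    and "(\<lambda>n. ereal (real (sep Y n))) \<simeq> (\<lambda>n. ereal (real n powr p * ln (real n) powr q))"
  shows "(\<lambda>n. if p > 0
              then ereal (real n powr (r / p) * ln (real n) powr ((s - q) / p))
              else ereal (exp (real n powr (r / (q + 1)) * ln (real n) powr (s / (q + 1)))))
         \<lesssim> (\<lambda>n. ereal_of_enat (wir_profile k X Y n))"
proof -
  obtain C\<^sub>1 :: nat where sep_X: "\<And>n. real n powr r * ln (real n) powr s
      \<le> real C\<^sub>1 * real (sep X (C\<^sub>1 * n)) + real C\<^sub>1"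
    using assms(9) unfolding lesssim_ereal_iff by blast
  \<comment> \<open>At 3 the logarithm is positive, so the left side is positive and
    \<open>C\<^sub>1 = 0\<close> is impossible.\<close>
  have "0 < real 3 powr r * ln (real 3) powr s" by simp
  also have "\<dots> \<le> real C\<^sub>1 * real (sep X (C\<^sub>1 * 3)) + real C\<^sub>1" by (rule sep_X)
  finally have C\<^sub>1: "0 < C\<^sub>1" by (cases "C\<^sub>1 = 0") auto
  obtain C :: nat where C: "\<And>n. real (sep Y n)
      \<le> real C * (real (C * n) powr p * ln (real (C * n)) powr q) + real C"
    using assms(10) unfolding simeq_def lesssim_ereal_iff by blast
  have "\<exists>C\<^sub>2::nat. 0 < C\<^sub>2 \<and> (\<forall>n. real (sep Y n)
      \<le> real C\<^sub>2 * (real (C\<^sub>2 * n) powr p * ln (real (C\<^sub>2 * n)) powr q) + real C\<^sub>2)"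
  proof (cases "C = 0")
    case True
    then have "sep Y n = 0" for n using C[of n] by simp
    then show ?thesis by (intro exI[of _ 1]) simp
  qed (use C in blast)
  then obtain C\<^sub>2 :: nat where C\<^sub>2: "0 < C\<^sub>2" and sep_Y: "\<And>n. real (sep Y n)
      \<le> real C\<^sub>2 * (real (C\<^sub>2 * n) powr p * ln (real (C\<^sub>2 * n)) powr q) + real C\<^sub>2"
    by blast
  obtain L where L: "0 < L" and wir: "\<And>m n. wir_profile k X Y m = enat n \<Longrightarrow>
      sep X m \<le> L * max 1 (sep Y n) \<and> m \<le> k * n"
    using wir_profile_bounds[OF assms(1,3,4,5)] by blast
  define L' where "L' = real C\<^sub>1 * real L * (1 + real C\<^sub>2) + real C\<^sub>1"
  have L': "0 < L'" using C\<^sub>1 by (simp add: L'_def add_nonneg_pos)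
  \<comment> \<open>The bound for \<open>sep Y\<close> is taken at \<open>k * N\<close> instead of
    \<open>N\<close>: its argument \<open>C\<^sub>2 * (k * N)\<close> is then at least
    \<open>n\<close>, as the inversion lemmas require.\<close>
  have key: "real n \<le> real (C\<^sub>2 * (k * N)) \<and> real n powr r * ln (real n) powr s
      \<le> L' * (real (C\<^sub>2 * (k * N)) powr p * ln (real (C\<^sub>2 * (k * N))) powr q + 1)"
    if "1 \<le> n" and N: "wir_profile k X Y (C\<^sub>1 * n) = enat N" for n N
  proof -
    define W where "W = real (C\<^sub>2 * (k * N)) powr p * ln (real (C\<^sub>2 * (k * N))) powr q"
    have W: "0 \<le> W" by (simp add: W_def)
    have "n \<le> C\<^sub>1 * n" "C\<^sub>1 * n \<le> k * N" "k * N \<le> C\<^sub>2 * (k * N)" using wir[OF N] C\<^sub>1 C\<^sub>2 by auto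
    then have n_le: "n \<le> k * N" "n \<le> C\<^sub>2 * (k * N)" by linarith+
    have "N \<le> k * N" using n_le \<open>1 \<le> n\<close> by (cases k) auto
    then have "real (sep Y N) \<le> real (sep Y (k * N))" by (intro of_nat_mono sep_mono)
    then have sYN: "real (max 1 (sep Y N)) \<le> 1 + (real C\<^sub>2 * W + real C\<^sub>2)"
      using sep_Y[of "k * N"] unfolding W_def by linarith
    have "real (sep X (C\<^sub>1 * n)) \<le> real (L * max 1 (sep Y N))"
      using wir[OF N] of_nat_le_iff by blast
    also have "\<dots> \<le> real L * (1 + (real C\<^sub>2 * W + real C\<^sub>2))"
      unfolding of_nat_mult using sYN by (rule mult_left_mono) simp
    finally have "real C\<^sub>1 * real (sep X (C\<^sub>1 * n)) + real C\<^sub>1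
        \<le> real C\<^sub>1 * (real L * (1 + (real C\<^sub>2 * W + real C\<^sub>2))) + real C\<^sub>1"
      by (simp add: mult_left_mono)
    also have "\<dots> \<le> L' * (W + 1)"
      using W by (simp add: L'_def algebra_simps)
    finally have "real n powr r * ln (real n) powr s \<le> L' * (W + 1)"
      using sep_X[of n] by linarith
    then show ?thesis using n_le(2) unfolding W_def of_nat_le_iff by blast
  qed
  show ?thesis
  proof (cases "p > 0")
    case True
    obtain K x\<^sub>0 where inv: "\<And>x y. x\<^sub>0 \<le> x \<Longrightarrow> x \<le> y \<Longrightarrow>
       x powr r * ln x powr s \<le> L' * (y powr p * ln y powr q + 1) \<Longrightarrow>
       x powr (r / p) * ln x powr ((s - q) / p) \<le> K * y"
      using polynomial_inversion[OF True assms(6) L'] by metis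
    have "(\<lambda>n. ereal (real n powr (r / p) * ln (real n) powr ((s - q) / p)))
        \<lesssim> (\<lambda>n. ereal_of_enat (wir_profile k X Y n))"
    proof (rule lesssim_ereal_of_enatI[OF wir_profile_mono])
      fix n N
      assume n: "max 1 (nat \<lceil>x\<^sub>0\<rceil>) \<le> n" and N: "wir_profile k X Y (C\<^sub>1 * n) = enat N"
      have "x\<^sub>0 \<le> real n" "1 \<le> n" using n by linarith+
      then have "real n powr (r / p) * ln (real n) powr ((s - q) / p) \<le> K * real (C\<^sub>2 * (k * N))"
        using inv key[OF _ N] by blast
      then show "real n powr (r / p) * ln (real n) powr ((s - q) / p) \<le> (K * real C\<^sub>2 * real k) * real N"
        by (simp add: mult_ac)
    qed
    then show ?thesis using True by simp
  next
    case False
    then have p: "p = 0" "-1 < q" using assms(7,8) by auto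
    obtain x\<^sub>0 where inv: "\<And>x y. x\<^sub>0 \<le> x \<Longrightarrow> x \<le> y \<Longrightarrow>
       x powr r * ln x powr s \<le> L' * (ln y powr q + 1) \<Longrightarrow>
       exp (x powr (r / (q + 1)) * ln x powr (s / (q + 1))) \<le> y"
      using exponential_inversion[OF p(2) L'] by metis
    have "(\<lambda>n. ereal (exp (real n powr (r / (q + 1)) * ln (real n) powr (s / (q + 1)))))
        \<lesssim> (\<lambda>n. ereal_of_enat (wir_profile k X Y n))"
    proof (rule lesssim_ereal_of_enatI[OF wir_profile_mono])
      fix n N
      assume n: "max 1 (nat \<lceil>x\<^sub>0\<rceil>) \<le> n" and N: "wir_profile k X Y (C\<^sub>1 * n) = enat N"
      have n': "x\<^sub>0 \<le> real n" "1 \<le> n" using n by linarith+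
      \<comment> \<open>Positivity matters because \<open>0 powr 0\<close> is 0, not 1.\<close>
      have "0 < real (C\<^sub>2 * (k * N))" using key[OF n'(2) N] n'(2) by linarith
      then have "real (C\<^sub>2 * (k * N)) powr p = 1"
        unfolding p(1) by (simp only: powr_zero_eq_one less_imp_neq[symmetric] if_False)
      then have "real n powr r * ln (real n) powr s \<le> L' * (ln (real (C\<^sub>2 * (k * N))) powr q + 1)"
        using key[OF n'(2) N] by simp
      then have "exp (real n powr (r / (q + 1)) * ln (real n) powr (s / (q + 1))) \<le> real (C\<^sub>2 * (k * N))"
        using inv n'(1) key[OF n'(2) N] by blast
      then show "exp (real n powr (r / (q + 1)) * ln (real n) powr (s / (q + 1)))
          \<le> (real C\<^sub>2 * real k) * real N"
        by (simp add: mult_ac)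
    qed
    then show ?thesis using False by simp
  qed
qed

end
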